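(* In the setting described in the context (with the relaxed barrier function based MPC cost $\hat{J}_N:\mathbb{R}^{Nm}\times\mathbb{R}^n\to\mathbb{R}_+$), the following hold. (i) There exist $\underline{\alpha},\bar{\alpha}\in\mathcal{K}_\infty$ such that $\underline{\alpha}(\|(U,x)\|)\le \hat{J}_N(U,x)\le \bar{\alpha}(\|(U,x)\|)$ for all $(U,x)\in\mathbb{R}^{Nm}\times\mathbb{R}^n$. (ii) $\hat{J}_N(U,x)$ is strongly convex in $U$ and convex in $x$, and there exist $\sigma,L>0$ such that for all $U,U_1,U_2\in\mathbb{R}^{Nm}$ and $x\in\mathbb{R}^n$: $\sigma I\preceq \nabla_U^2\hat{J}_N(U,x)\preceq L I$ and $\|\nabla_U\hat{J}_N(U_1,x)-\nabla_U\hat{J}_N(U_2,x)\|\le L\|U_1-U_2\|$. (iii) There exists a function $k_f:\mathbb{R}^{Nm}\times\mathbb{R}^n\to\mathbb{R}^m$ with $k_f(0,0)=0$ such that for every $(U_0,x_0)\in\mathbb{R}^{Nm}\times\mathbb{R}^n$, writing $U_0=(u_0,\dots,u_{N-1})$, $x_0^+:=Ax_0+Bu_0$ and $U_0^+:=(u_1,\dots,u_{N-1},k_f(U_0,x_0))$, one has $\hat{J}_N(U_0^+,x_0^+)-\hat{J}_N(U_0,x_0)\le -\hat{\ell}(x_0,u_0)$.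
   Context: Let $n,m,N\in\mathbb{N}_+$, $A\in\mathbb{R}^{n\times n}$, $B\in\mathbb{R}^{n\times m}$ with $(A,B)$ stabilizable. Let $\mathcal{X}=\{x\in\mathbb{R}^n: C_{\mathrm{x}}x\le d_{\mathrm{x}}\}$ and $\mathcal{U}=\{u\in\mathbb{R}^m: C_{\mathrm{u}}u\le d_{\mathrm{u}}\}$ be compact polytopes, with $C_{\mathrm{x}}\in\mathbb{R}^{q_{\mathrm{x}}\times n}$, $C_{\mathrm{u}}\in\mathbb{R}^{q_{\mathrm{u}}\times m}$ and $d_{\mathrm{x}}\in\mathbb{R}^{q_{\mathrm{x}}}$, $d_{\mathrm{u}}\in\mathbb{R}^{q_{\mathrm{u}}}$ having all entries strictly positive; a superscript $i$ denotes the $i$-th row of a matrix or entry of a vector, and $\mathds{1}$ is the all-ones vector. Fix $\varepsilon>0$, $Q$ symmetric positive semidefinite, $R$ symmetric positive definite, a relaxation parameter $\delta$ with $0<\delta\le\min\{d_{\mathrm{x}}^1,\dots,d_{\mathrm{x}}^{q_{\mathrm{x}}},d_{\mathrm{u}}^1,\dots,d_{\mathrm{u}}^{q_{\mathrm{u}}}\}$, and weight vectors $w_{\mathrm{x}}\in\mathbb{R}^{q_{\mathrm{x}}}$, $w_{\mathrm{u}}\in\mathbb{R}^{q_{\mathrm{u}}}$ with nonnegative entries satisfying $C_{\mathrm{x}}^\top\mathrm{diag}(1/d_{\mathrm{x}}^1,\dots,1/d_{\mathrm{x}}^{q_{\mathrm{x}}})(\mathds{1}+w_{\mathrm{x}})=0$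 and $C_{\mathrm{u}}^\top\mathrm{diag}(1/d_{\mathrm{u}}^1,\dots,1/d_{\mathrm{u}}^{q_{\mathrm{u}}})(\mathds{1}+w_{\mathrm{u}})=0$. The relaxed logarithmic barrier is $\hat{B}(z)=-\ln z$ for $z>\delta$ and $\hat{B}(z)=\tfrac12\big[\big(\tfrac{z-2\delta}{\delta}\big)^2-1\big]-\ln\delta$ for $z\le\delta$. The recentered relaxed barriers are $\hat{B}_{\mathrm{x}}(x)=\sum_{i=1}^{q_{\mathrm{x}}}(1+w_{\mathrm{x}}^i)\big(\hat{B}(-C_{\mathrm{x}}^ix+d_{\mathrm{x}}^i)+\ln d_{\mathrm{x}}^i\big)$ and $\hat{B}_{\mathrm{u}}(u)=\sum_{j=1}^{q_{\mathrm{u}}}(1+w_{\mathrm{u}}^j)\big(\hat{B}(-C_{\mathrm{u}}^ju+d_{\mathrm{u}}^j)+\ln d_{\mathrm{u}}^j\big)$. The stage cost is $\hat{\ell}(x,u)=x^\top Qx+u^\top Ru+\varepsilon\hat{B}_{\mathrm{x}}(x)+\varepsilon\hat{B}_{\mathrm{u}}(u)$. Let $M_{\mathrm{x}}=\frac{1}{2\delta^2}C_{\mathrm{x}}^\top\mathrm{diag}(\mathds{1}+w_{\mathrm{x}})C_{\mathrm{x}}$, $M_{\mathrm{u}}=\frac{1}{2\delta^2}C_{\mathrm{u}}^\top\mathrm{diag}(\mathds{1}+w_{\mathrm{u}})C_{\mathrm{u}}$, and let $P$ be a symmetric positive definite matrix solving $K=-(R+B^\top PB+\varepsilon M_{\mathrm{u}})^{-1}B^\top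 PA$, $P=(A+BK)^\top P(A+BK)+K^\top(R+\varepsilon M_{\mathrm{u}})K+Q+\varepsilon M_{\mathrm{x}}$. For a stacked input vector $U=(u_0,\dots,u_{N-1})\in\mathbb{R}^{Nm}$ and $x\in\mathbb{R}^n$, let $x_0=x$ and $x_{k+1}=Ax_k+Bu_k$, i.e. $x_k(U,x)=A^kx+\sum_{i=0}^{k-1}A^iBu_{k-1-i}$, and define $\hat{J}_N(U,x)=\sum_{k=0}^{N-1}\hat{\ell}(x_k,u_k)+x_N^\top Px_N$. A function $\alpha:\mathbb{R}_+\to\mathbb{R}_+$ is in $\mathcal{K}_\infty$ if it is continuous, strictly increasing, $\alpha(0)=0$ and $\alpha(s)\to\infty$ as $s\to\infty$. *)

theory Defs
  imports "HOL-Analysis.Analysis"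
begin

section \<open>Linear-algebra notions\<close>

definition diag_mat :: "real^'q \<Rightarrow> real^'q^'q" where
  "diag_mat v = (\<chi> i j. if i = j then v $ i else 0)"

definition sym_mat :: "real^'n^'n \<Rightarrow> bool" where
  "sym_mat M \<longleftrightarrow> transpose M = M"

definition psd_mat :: "real^'n^'n \<Rightarrow> bool" where
  "psd_mat M \<longleftrightarrow> sym_mat M \<and> (\<forall>x. 0 \<le> x \<bullet> (M *v x))"

definition pd_mat :: "real^'n^'n \<Rightarrow> bool" where
  "pd_mat M \<longleftrightarrow> sym_mat M \<and> (\<forall>x. x \<noteq> 0 \<longrightarrow> 0 < x \<bullet> (M *v x))"

text \<open>Schur stability: every (complex) eigenvalue has modulus < 1.\<close>
definition schur_stable :: "real^'n^'n \<Rightarrow> bool" where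
  "schur_stable M \<longleftrightarrow>
     (\<forall>(lam::complex) (v::complex^'n). v \<noteq> 0 \<and>
        (\<chi> i j. complex_of_real (M $ i $ j)) *v v = lam *s v \<longrightarrow> cmod lam < 1)"

definition stabilizable :: "real^'n^'n \<Rightarrow> real^'m^'n \<Rightarrow> bool" where
  "stabilizable A B \<longleftrightarrow> (\<exists>K :: real^'n^'m. schur_stable (A + B ** K))"

section \<open>Comparison functions and strong convexity\<close>

definition K_inf :: "(real \<Rightarrow> real) \<Rightarrow> bool" where
  "K_inf \<alpha> \<longleftrightarrow> continuous_on {0..} \<alpha> \<and> strict_mono_on {0..} \<alpha> \<and> \<alpha> 0 = 0
     \<and> (\<forall>s\<ge>0. 0 \<le> \<alpha> s) \<and> filterlim \<alpha> at_top at_top"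

definition strongly_convex_on :: "'a::real_normed_vector set \<Rightarrow> ('a \<Rightarrow> real) \<Rightarrow> bool" where
  "strongly_convex_on S f \<longleftrightarrow> (\<exists>\<mu>>0. \<forall>x\<in>S. \<forall>y\<in>S. \<forall>t\<in>{0..1}.
      f ((1 - t) *\<^sub>R x + t *\<^sub>R y) \<le> (1 - t) * f x + t * f y - \<mu> / 2 * t * (1 - t) * (norm (x - y))\<^sup>2)"

section \<open>Relaxed barrier and MPC cost\<close>

definition relaxed_barrier :: "real \<Rightarrow> real \<Rightarrow> real" where
  "relaxed_barrier \<delta> z = (if z > \<delta> then - ln z else 1/2 * (((z - 2*\<delta>) / \<delta>)\<^sup>2 - 1) - ln \<delta>)"

text \<open>Recentered relaxed barrier for the polytope {y. C y \<le> d} with weights w.\<close>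
definition rec_barrier :: "real \<Rightarrow> real^'k^'q \<Rightarrow> real^'q \<Rightarrow> real^'q \<Rightarrow> real^'k \<Rightarrow> real" where
  "rec_barrier \<delta> C d w y = (\<Sum>i\<in>UNIV. (1 + w $ i) * (relaxed_barrier \<delta> (- ((C $ i) \<bullet> y) + d $ i) + ln (d $ i)))"

definition stage_cost ::
  "real^'n^'n \<Rightarrow> real^'m^'m \<Rightarrow> real \<Rightarrow> real \<Rightarrow> real^'n^'qx \<Rightarrow> real^'qx \<Rightarrow> real^'qx
   \<Rightarrow> real^'m^'qu \<Rightarrow> real^'qu \<Rightarrow> real^'qu \<Rightarrow> real^'n \<Rightarrow> real^'m \<Rightarrow> real" where
  "stage_cost Q R \<epsilon> \<delta> Cx dx wx Cu du wu x u =
     x \<bullet> (Q *v x) + u \<bullet> (R *v u) + \<epsilon> * rec_barrier \<delta> Cx dx wx x + \<epsilon> * rec_barrier \<delta> Cu du wu u"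

text \<open>Stacked input vectors U = (u_0,...,u_{N-1}) live in real^'m^'N with N = CARD('N::enum);
  the k-th block is the entry at the k-th element of the enumeration of 'N.\<close>
definition blk :: "real^'m^'N::enum \<Rightarrow> nat \<Rightarrow> real^'m" where
  "blk U k = U $ (enum_class.enum ! k)"

definition blk_idx :: "'N::enum \<Rightarrow> nat" where
  "blk_idx j = (THE k. k < length (enum_class.enum :: 'N::enum list) \<and> enum_class.enum ! k = j)"

text \<open>Shifted input sequence (u_1,...,u_{N-1}, v).\<close>
definition shift_in :: "real^'m^'N::enum \<Rightarrow> real^'m \<Rightarrow> real^'m^'N::enum" where
  "shift_in U v = (\<chi> j. if blk_idx j + 1 < CARD('N::enum) then blk U (blk_idx j + 1) else v)"

primrec traj :: "real^'n^'n \<Rightarrow> real^'m^'n \<Rightarrow> real^'n \<Rightarrow> (nat \<Rightarrow> real^'m) \<Rightarrow> nat \<Rightarrow> real^'n" where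
  "traj A B x u 0 = x"
| "traj A B x u (Suc k) = A *v traj A B x u k + B *v u k"

definition mpc_cost ::
  "real^'n^'n \<Rightarrow> real^'m^'n \<Rightarrow> real^'n^'n \<Rightarrow> real^'m^'m \<Rightarrow> real^'n^'n \<Rightarrow> real \<Rightarrow> real
   \<Rightarrow> real^'n^'qx \<Rightarrow> real^'qx \<Rightarrow> real^'qx \<Rightarrow> real^'m^'qu \<Rightarrow> real^'qu \<Rightarrow> real^'qu
   \<Rightarrow> real^'m^'N::enum \<Rightarrow> real^'n \<Rightarrow> real" where
  "mpc_cost A B Q R P \<epsilon> \<delta> Cx dx wx Cu du wu U x =
     (\<Sum>k<CARD('N::enum). stage_cost Q R \<epsilon> \<delta> Cx dx wx Cu du wu (traj A B x (blk U) k) (blk U k))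
     + traj A B x (blk U) CARD('N::enum) \<bullet> (P *v traj A B x (blk U) CARD('N::enum))"

end

theory Submission
  imports Defs
begin

text \<open>The centering condition on the weights makes each recentred barrier a weighted sum of
  functions of the row values \<open>C\<^sub>i y\<close> that vanish together with their slope at \<open>0\<close>. As the
  relaxed barrier has second derivative in \<open>(0, 1/\<delta>\<^sup>2]\<close>, Taylor's theorem squeezes the barriers
  between \<open>0\<close> and the quadratic forms \<open>y\<^sup>T M y\<close>. This gives a quadratic upper comparison function
  and, since compactness of \<open>X\<close> lets a single row value dominate \<open>|x|\<close>, a lower one of the form
  \<open>min (r\<^sup>2) r\<close>. In the inputs the cost is the quadratic form of the block-diagonal weight
  \<open>diag(R, \<dots>, R)\<close> plus convex functions of linear images of \<open>(U, x)\<close> with bounded Hessians,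
  which gives (ii). Finally the Riccati equation together with the quadratic majorants of the
  barriers makes \<open>x\<^sup>T P x\<close> decrease along \<open>u = K x\<close> by at least the stage cost, so appending
  \<open>K x\<^sub>N\<close> to the shifted input sequence yields (iii).\<close>

section \<open>Real functions with bounded second derivative\<close>

lemma has_real_derivative_piecewise:
  fixes f g f' g' :: "real \<Rightarrow> real"
  assumes f: "\<And>z. c \<le> z \<Longrightarrow> (f has_real_derivative f' z) (at z)"
    and g: "\<And>z. z \<le> c \<Longrightarrow> (g has_real_derivative g' z) (at z)"
    and "f c = g c" and "f' c = g' c"
  shows "((\<lambda>z. if c < z then f z else g z) has_real_derivative (if c < z then f' z else g' z)) (at z)"
proof -
  have "((\<lambda>z. if z \<in> {c<..} then f z else g z) has_derivative
      (if z \<in> {c<..} then (*) (f' z) else (*) (g' z))) (at z within {c<..} \<union> {..c})"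
  proof (rule has_derivative_If_within_closures)
    show "(f has_derivative (*) (f' z)) (at z within {c<..} \<union> (closure {c<..} \<inter> closure {..c}))"
      if "z \<in> {c<..} \<union> (closure {c<..} \<inter> closure {..c})"
      using f[of z] that by (auto simp: has_field_derivative_def intro: has_derivative_at_withinI)
    show "(g has_derivative (*) (g' z)) (at z within {..c} \<union> (closure {c<..} \<inter> closure {..c}))"
      if "z \<in> {..c} \<union> (closure {c<..} \<inter> closure {..c})"
      using g[of z] that by (auto simp: has_field_derivative_def intro: has_derivative_at_withinI)
  qed (use assms in auto)
  moreover have "{c<..} \<union> {..c} = UNIV" by auto
  ultimately show ?thesis
    unfolding has_field_derivative_def by (simp add: if_distrib[of "(*)"] cong: if_cong)
qed

lemma increment_ge_of_deriv_ge:
  fixes f f' :: "real \<Rightarrow> real"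
  assumes "a \<le> b" and f: "\<And>x. (f has_real_derivative f' x) (at x)"
    and f'_ge: "\<And>x. a \<le> x \<Longrightarrow> x \<le> b \<Longrightarrow> c \<le> f' x"
  shows "c * (b - a) \<le> f b - f a"
proof -
  have "f a - c * a \<le> f b - c * b"
  proof (rule DERIV_nonneg_imp_nondecreasing[of a b "\<lambda>t. f t - c * t"])
    fix x :: real assume "a \<le> x" "x \<le> b"
    then have "0 \<le> f' x - c" using f'_ge by simp
    moreover have "((\<lambda>t. f t - c * t) has_real_derivative f' x - c) (at x)"
      using f[of x] by (auto intro!: derivative_eq_intros)
    ultimately show "\<exists>y. ((\<lambda>t. f t - c * t) has_real_derivative y) (at x) \<and> 0 \<le> y" by blast
  qed fact
  then show ?thesis by (simp add: algebra_simps)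
qed

lemma second_order_nonneg:
  fixes f f' f'' :: "real \<Rightarrow> real"
  assumes f: "\<And>t. (f has_real_derivative f' t) (at t)"
    and f': "\<And>t. (f' has_real_derivative f'' t) (at t)"
    and "\<And>t. 0 \<le> f'' t" and "f 0 = 0" and "f' 0 = 0"
  shows "0 \<le> f s"
proof -
  have f'_mono: "f' a \<le> f' b" if "a \<le> b" for a b
    using increment_ge_of_deriv_ge[OF that f', of 0] assms(3) by simp
  show ?thesis
  proof (cases "0 \<le> s")
    case True
    with increment_ge_of_deriv_ge[OF True f, of 0] f'_mono[of 0] assms(4,5) show ?thesis by simp
  next
    case False
    have "((\<lambda>t. - f t) has_real_derivative - f' t) (at t)" for t
      using f by (auto intro!: derivative_eq_intros)
    with increment_ge_of_deriv_ge[of s 0 "\<lambda>t. - f t" "\<lambda>t. - f' t" 0] False f'_mono[of _ 0] assms(4,5)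
    show ?thesis by simp
  qed
qed

lemma second_order_upper:
  fixes f f' f'' :: "real \<Rightarrow> real"
  assumes f: "\<And>t. (f has_real_derivative f' t) (at t)"
    and f': "\<And>t. (f' has_real_derivative f'' t) (at t)"
    and "\<And>t. f'' t \<le> M" and "f 0 = 0" and "f' 0 = 0"
  shows "f s \<le> M / 2 * s\<^sup>2"
proof -
  have "0 \<le> M / 2 * s\<^sup>2 - f s"
  proof (rule second_order_nonneg[where f = "\<lambda>s. M / 2 * s\<^sup>2 - f s" and f' = "\<lambda>t. M * t - f' t"
        and f'' = "\<lambda>t. M - f'' t"])
    show "((\<lambda>s. M / 2 * s\<^sup>2 - f s) has_real_derivative M * t - f' t) (at t)" for t
      using f[of t] by (auto intro!: derivative_eq_intros)
    show "((\<lambda>t. M * t - f' t) has_real_derivative M - f'' t) (at t)" for t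
      using f'[of t] by (auto intro!: derivative_eq_intros)
  qed (use assms in auto)
  then show ?thesis by simp
qed

text \<open>Beyond the unit interval only convexity is available, so the quadratic lower bound
  degrades to a linear one.\<close>
lemma second_order_lower_nonneg:
  fixes f f' f'' :: "real \<Rightarrow> real"
  assumes f: "\<And>t. (f has_real_derivative f' t) (at t)"
    and f': "\<And>t. (f' has_real_derivative f'' t) (at t)"
    and f''_nonneg: "\<And>t. 0 \<le> f'' t" and f''_ge: "\<And>t. \<bar>t\<bar> \<le> 1 \<Longrightarrow> m \<le> f'' t" and "0 \<le> m"
    and "f 0 = 0" and "f' 0 = 0" and "0 \<le> s"
  shows "m / 2 * min (s\<^sup>2) s \<le> f s"
proof -
  have f'_ge: "m * t \<le> f' t" if "0 \<le> t" "t \<le> 1" for t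
    using increment_ge_of_deriv_ge[OF that(1) f', of m] that f''_ge \<open>f' 0 = 0\<close> by simp
  have f_ge: "m / 2 * t\<^sup>2 \<le> f t" if "0 \<le> t" "t \<le> 1" for t
  proof -
    have "((\<lambda>t. f t - m / 2 * t\<^sup>2) has_real_derivative f' x - m * x) (at x)" for x
      using f[of x] by (auto intro!: derivative_eq_intros)
    from increment_ge_of_deriv_ge[OF that(1) this, of 0] show ?thesis
      using that f'_ge \<open>f 0 = 0\<close> by simp
  qed
  show ?thesis
  proof (cases "s \<le> 1")
    case True
    then have "s\<^sup>2 \<le> s" using \<open>0 \<le> s\<close> by (simp add: power2_eq_square mult_left_le_one_le)
    then show ?thesis using f_ge[OF \<open>0 \<le> s\<close> True] by (simp add: min_def)
  next
    case False
    have "m \<le> f' x" if "1 \<le> x" for x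
      using f'_ge[of 1] increment_ge_of_deriv_ge[OF that f', of 0] f''_nonneg by simp
    then have "m * (s - 1) \<le> f s - f 1"
      using False by (intro increment_ge_of_deriv_ge[OF _ f]) auto
    moreover have "m / 2 * s = m / 2 + m / 2 * (s - 1)" by (simp add: right_diff_distrib)
    moreover have "m / 2 * (s - 1) \<le> m * (s - 1)" using False \<open>0 \<le> m\<close> by simp
    moreover have "m / 2 \<le> f 1" using f_ge[of 1] by simp
    ultimately have "m / 2 * s \<le> f s" by linarith
    moreover have "min (s\<^sup>2) s = s" using False by (simp add: min_def power2_eq_square)
    ultimately show ?thesis by simp
  qed
qed

lemma second_order_lower:
  fixes f f' f'' :: "real \<Rightarrow> real"
  assumes f: "\<And>t. (f has_real_derivative f' t) (at t)"
    and f': "\<And>t. (f' has_real_derivative f'' t) (at t)"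
    and "\<And>t. 0 \<le> f'' t" and "\<And>t. \<bar>t\<bar> \<le> 1 \<Longrightarrow> m \<le> f'' t" and "0 \<le> m"
    and "f 0 = 0" and "f' 0 = 0"
  shows "m / 2 * min (s\<^sup>2) \<bar>s\<bar> \<le> f s"
proof (cases "0 \<le> s")
  case True
  then show ?thesis using second_order_lower_nonneg[OF assms True] by simp
next
  case False
  have "m / 2 * min ((- s)\<^sup>2) (- s) \<le> f (- (- s))"
  proof (rule second_order_lower_nonneg[where f = "\<lambda>t. f (- t)" and f' = "\<lambda>t. - f' (- t)"
        and f'' = "\<lambda>t. f'' (- t)"])
    show "((\<lambda>t. f (- t)) has_real_derivative - f' (- t)) (at t)" for t
      using DERIV_mirror[of f "f' (- t)" t] f by simp
    show "((\<lambda>t. - f' (- t)) has_real_derivative f'' (- t)) (at t)" for t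
      using DERIV_mirror[of f' "f'' (- t)" t] f' by (auto intro!: derivative_eq_intros)
  qed (use assms False in auto)
  then show ?thesis using False by simp
qed

definition quad_lin :: "real \<Rightarrow> real" where
  "quad_lin r = min (r\<^sup>2) r"

lemma quad_lin_nonneg: "0 \<le> r \<Longrightarrow> 0 \<le> quad_lin r"
  by (simp add: quad_lin_def)

lemma quad_lin_mono: "0 \<le> a \<Longrightarrow> a \<le> b \<Longrightarrow> quad_lin a \<le> quad_lin b"
  unfolding quad_lin_def by (metis min.mono power_mono)

lemma quad_lin_le_square: "0 \<le> r \<Longrightarrow> quad_lin r \<le> r\<^sup>2"
  by (simp add: quad_lin_def)

lemma quad_lin_divide_ge:
  assumes "1 \<le> c" and "0 \<le> r"
  shows "quad_lin r / c\<^sup>2 \<le> quad_lin (r / c)"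
proof -
  have "1 * c \<le> c * c" using assms by (intro mult_right_mono) auto
  then have "r / c\<^sup>2 \<le> r / c"
    using assms by (intro divide_left_mono) (auto simp: power2_eq_square)
  moreover have "min (r\<^sup>2) r / c\<^sup>2 = min (r\<^sup>2 / c\<^sup>2) (r / c\<^sup>2)"
    using assms by (simp add: min_divide_distrib_right)
  ultimately show ?thesis by (auto simp: quad_lin_def power_divide min_def)
qed

section \<open>The relaxed barrier\<close>

definition relaxed_barrier_deriv :: "real \<Rightarrow> real \<Rightarrow> real" where
  "relaxed_barrier_deriv \<delta> z = (if \<delta> < z then - 1 / z else (z - 2 * \<delta>) / \<delta>\<^sup>2)"

definition relaxed_barrier_deriv2 :: "real \<Rightarrow> real \<Rightarrow> real" where
  "relaxed_barrier_deriv2 \<delta> z = (if \<delta> < z then 1 / z\<^sup>2 else 1 / \<delta>\<^sup>2)"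

lemma has_real_derivative_relaxed_barrier:
  assumes "0 < \<delta>"
  shows "(relaxed_barrier \<delta> has_real_derivative relaxed_barrier_deriv \<delta> z) (at z)"
  unfolding relaxed_barrier_def[abs_def] relaxed_barrier_deriv_def
  by (rule has_real_derivative_piecewise)
     (use assms in \<open>auto intro!: derivative_eq_intros simp: field_simps power2_eq_square\<close>)

lemma has_real_derivative_relaxed_barrier_deriv:
  assumes "0 < \<delta>"
  shows "(relaxed_barrier_deriv \<delta> has_real_derivative relaxed_barrier_deriv2 \<delta> z) (at z)"
  unfolding relaxed_barrier_deriv_def[abs_def] relaxed_barrier_deriv2_def
  by (rule has_real_derivative_piecewise)
     (use assms in \<open>auto intro!: derivative_eq_intros simp: field_simps power2_eq_square\<close>)

lemma relaxed_barrier_deriv2_pos: "0 < \<delta> \<Longrightarrow> 0 < relaxed_barrier_deriv2 \<delta> z"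
  by (simp add: relaxed_barrier_deriv2_def)

lemma relaxed_barrier_deriv2_le: "0 < \<delta> \<Longrightarrow> relaxed_barrier_deriv2 \<delta> z \<le> 1 / \<delta>\<^sup>2"
  by (auto simp: relaxed_barrier_deriv2_def divide_simps power_mono)

lemma relaxed_barrier_deriv2_ge: "0 < \<delta> \<Longrightarrow> \<delta> \<le> D \<Longrightarrow> z \<le> D \<Longrightarrow> 1 / D\<^sup>2 \<le> relaxed_barrier_deriv2 \<delta> z"
  by (auto simp: relaxed_barrier_deriv2_def divide_simps power_mono)

lemma relaxed_barrier_deriv_mono:
  "0 < \<delta> \<Longrightarrow> a \<le> b \<Longrightarrow> relaxed_barrier_deriv \<delta> a \<le> relaxed_barrier_deriv \<delta> b"
  by (rule DERIV_nonneg_imp_nondecreasing[of a b])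
     (auto intro: has_real_derivative_relaxed_barrier_deriv less_imp_le relaxed_barrier_deriv2_pos)

lemma relaxed_barrier_deriv_lipschitz:
  assumes "0 < \<delta>"
  shows "\<bar>relaxed_barrier_deriv \<delta> a - relaxed_barrier_deriv \<delta> b\<bar> \<le> \<bar>a - b\<bar> / \<delta>\<^sup>2"
proof -
  have "relaxed_barrier_deriv \<delta> y - relaxed_barrier_deriv \<delta> x \<le> (y - x) / \<delta>\<^sup>2" if "x < y" for x y
  proof -
    obtain z where "relaxed_barrier_deriv \<delta> y - relaxed_barrier_deriv \<delta> x = (y - x) * relaxed_barrier_deriv2 \<delta> z"
      using MVT2[OF \<open>x < y\<close>] has_real_derivative_relaxed_barrier_deriv[OF assms] by metis
    also have "\<dots> \<le> (y - x) * (1 / \<delta>\<^sup>2)"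
      using that relaxed_barrier_deriv2_le[OF assms] by (intro mult_left_mono) auto
    finally show ?thesis by simp
  qed
  then show ?thesis
    using relaxed_barrier_deriv_mono[OF assms, of a b] relaxed_barrier_deriv_mono[OF assms, of b a]
    by (cases a b rule: linorder_cases) (auto simp: abs_if)
qed

lemma convex_on_relaxed_barrier: "0 < \<delta> \<Longrightarrow> convex_on UNIV (relaxed_barrier \<delta>)"
  by (rule convex_on_realI[where f' = "relaxed_barrier_deriv \<delta>"])
     (auto intro: has_real_derivative_relaxed_barrier relaxed_barrier_deriv_mono)

text \<open>A row term of the recentred barrier minus its tangent at \<open>s = 0\<close>; by the centering
  condition the tangent parts cancel in the weighted sum over the rows.\<close>
definition barrier_excess :: "real \<Rightarrow> real \<Rightarrow> real \<Rightarrow> real" where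
  "barrier_excess \<delta> d s = relaxed_barrier \<delta> (d - s) + ln d - s / d"

lemma barrier_excess_derivatives:
  assumes "0 < \<delta>" and "d \<noteq> 0"
  shows "(barrier_excess \<delta> d has_real_derivative - relaxed_barrier_deriv \<delta> (d - s) - 1 / d) (at s)"
    and "((\<lambda>s. - relaxed_barrier_deriv \<delta> (d - s) - 1 / d)
          has_real_derivative relaxed_barrier_deriv2 \<delta> (d - s)) (at s)"
proof -
  have "((\<lambda>s. relaxed_barrier \<delta> (d - s)) has_real_derivative relaxed_barrier_deriv \<delta> (d - s) * - 1) (at s)"
    by (rule DERIV_chain2[OF has_real_derivative_relaxed_barrier[OF assms(1)]])
       (auto intro!: derivative_eq_intros)
  then show "(barrier_excess \<delta> d has_real_derivative - relaxed_barrier_deriv \<delta> (d - s) - 1 / d) (at s)"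
    unfolding barrier_excess_def[abs_def] using assms(2) by (auto intro!: derivative_eq_intros)
  have "((\<lambda>s. relaxed_barrier_deriv \<delta> (d - s)) has_real_derivative relaxed_barrier_deriv2 \<delta> (d - s) * - 1) (at s)"
    by (rule DERIV_chain2[OF has_real_derivative_relaxed_barrier_deriv[OF assms(1)]])
       (auto intro!: derivative_eq_intros)
  then show "((\<lambda>s. - relaxed_barrier_deriv \<delta> (d - s) - 1 / d)
      has_real_derivative relaxed_barrier_deriv2 \<delta> (d - s)) (at s)"
    by (auto intro!: derivative_eq_intros)
qed

lemma barrier_excess_at_zero:
  assumes "0 < \<delta>" and "\<delta> \<le> d"
  shows "barrier_excess \<delta> d 0 = 0" and "- relaxed_barrier_deriv \<delta> (d - 0) - 1 / d = 0"
  using assms by (auto simp: barrier_excess_def relaxed_barrier_def relaxed_barrier_deriv_def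
      field_simps power2_eq_square)

lemma barrier_excess_le:
  assumes "0 < \<delta>" and "\<delta> \<le> d"
  shows "barrier_excess \<delta> d s \<le> s\<^sup>2 / (2 * \<delta>\<^sup>2)"
  using second_order_upper[OF barrier_excess_derivatives[OF assms(1)] relaxed_barrier_deriv2_le
      barrier_excess_at_zero[OF assms], of s] assms
  by simp

lemma barrier_excess_nonneg:
  assumes "0 < \<delta>" and "\<delta> \<le> d"
  shows "0 \<le> barrier_excess \<delta> d s"
  using second_order_nonneg[OF barrier_excess_derivatives[OF assms(1)] _ barrier_excess_at_zero[OF assms]]
    relaxed_barrier_deriv2_pos[OF assms(1)] assms
  by (simp add: less_imp_le)

lemma barrier_excess_ge:
  assumes "0 < \<delta>" and "\<delta> \<le> d" and "d \<le> D"
  shows "quad_lin \<bar>s\<bar> / (2 * (D + 1)\<^sup>2) \<le> barrier_excess \<delta> d s"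
proof -
  have "d \<noteq> 0" using assms by simp
  have "1 / (D + 1)\<^sup>2 \<le> relaxed_barrier_deriv2 \<delta> (d - t)" if "\<bar>t\<bar> \<le> 1" for t
    using assms that by (intro relaxed_barrier_deriv2_ge) auto
  from second_order_lower[OF barrier_excess_derivatives[OF assms(1) \<open>d \<noteq> 0\<close>] _ this _
      barrier_excess_at_zero[OF assms(1,2)]]
  have "1 / (D + 1)\<^sup>2 / 2 * min (s\<^sup>2) \<bar>s\<bar> \<le> barrier_excess \<delta> d s"
    using relaxed_barrier_deriv2_pos[OF assms(1)] by (simp add: less_imp_le)
  then show ?thesis by (simp add: quad_lin_def)
qed

section \<open>Quadratic forms and convexity\<close>

lemma inner_transpose_mult: "y \<bullet> (transpose C *v z) = (C *v y) \<bullet> (z :: real^'q)"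
proof -
  have "y \<bullet> (transpose C *v z) = (z v* C) \<bullet> y"
    unfolding transpose_matrix_vector by (rule inner_commute)
  also have "\<dots> = z \<bullet> (C *v y)" by (rule dot_lmul_matrix)
  finally show ?thesis by (simp add: inner_commute)
qed

lemma sym_mat_inner_mult: "sym_mat M \<Longrightarrow> a \<bullet> (M *v b) = (M *v a) \<bullet> (b :: real^'n)"
  using inner_transpose_mult[of a M b] by (simp add: sym_mat_def)

lemma diag_mat_mult_vector: "diag_mat v *v z = (\<chi> i. v $ i * z $ i)"
proof -
  have "(\<Sum>j\<in>UNIV. (if i = j then v $ i else 0) * z $ j) = v $ i * z $ i" for i
    by (simp add: if_distrib[of "\<lambda>a. a * _"] cong: if_cong)
  then show ?thesis by (simp add: diag_mat_def matrix_vector_mult_def vec_eq_iff)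
qed

lemma quadratic_form_weighted_rows:
  "y \<bullet> ((transpose C ** diag_mat v ** C) *v y) = (\<Sum>i\<in>UNIV. v $ i * (C $ i \<bullet> y)\<^sup>2)"
proof -
  have "y \<bullet> ((transpose C ** diag_mat v ** C) *v y) = (C *v y) \<bullet> (diag_mat v *v (C *v y))"
    by (simp only: matrix_vector_mul_assoc[symmetric] matrix_mul_assoc inner_transpose_mult)
  then show ?thesis
    by (simp add: diag_mat_mult_vector inner_vec_def matrix_vector_mul_component power2_eq_square
        mult.commute mult.left_commute)
qed

lemma quadratic_form_congruence:
  "y \<bullet> ((transpose M ** S ** M) *v y) = (M *v y) \<bullet> (S *v (M *v (y :: real^'n)))"
  by (simp only: matrix_vector_mul_assoc[symmetric] matrix_mul_assoc inner_transpose_mult)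

lemma quadratic_form_le_onorm:
  fixes M :: "real^'n^'n"
  shows "y \<bullet> (M *v y) \<le> onorm ((*v) M) * (norm y)\<^sup>2"
proof -
  have "bounded_linear ((*v) M)" by (simp add: linear_conv_bounded_linear[symmetric])
  have "y \<bullet> (M *v y) \<le> norm y * norm (M *v y)" by (rule norm_cauchy_schwarz)
  also have "\<dots> \<le> norm y * (onorm ((*v) M) * norm y)"
    by (rule mult_left_mono[OF onorm[OF \<open>bounded_linear _\<close>]]) simp
  finally show ?thesis by (simp add: power2_eq_square algebra_simps)
qed

lemma onorm_matrix_nonneg: "0 \<le> onorm ((*v) (M :: real^'n^'m))"
  by (rule onorm_pos_le) (simp add: linear_conv_bounded_linear[symmetric])

lemma pd_mat_imp_psd_mat: "pd_mat M \<Longrightarrow> psd_mat M"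
  unfolding pd_mat_def psd_mat_def by (metis inner_zero_left order_le_less)

lemma pd_mat_coercive:
  fixes R :: "real^'m^'m"
  assumes "pd_mat R"
  obtains l where "0 < l" and "\<And>h. l * (norm h)\<^sup>2 \<le> h \<bullet> (R *v h)"
proof -
  let ?S = "sphere (0 :: real^'m) 1"
  obtain e :: "real^'m" where "norm e = 1" using vector_choose_size[of 1] by auto
  then have "?S \<noteq> {}" by auto
  moreover have "continuous_on ?S (\<lambda>h. h \<bullet> (R *v h))"
    by (intro continuous_on_inner continuous_on_id linear_continuous_on)
       (simp add: linear_conv_bounded_linear[symmetric])
  ultimately obtain u where u: "u \<in> ?S" and u_min: "\<And>y. y \<in> ?S \<Longrightarrow> u \<bullet> (R *v u) \<le> y \<bullet> (R *v y)"
    using continuous_attains_inf[OF compact_sphere] by blast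
  have "u \<noteq> 0" using u by auto
  with assms have "0 < u \<bullet> (R *v u)" by (simp add: pd_mat_def)
  moreover have "u \<bullet> (R *v u) * (norm h)\<^sup>2 \<le> h \<bullet> (R *v h)" for h
  proof (cases "h = 0")
    case False
    define s where "s = inverse (norm h)"
    have "u \<bullet> (R *v u) \<le> (s *\<^sub>R h) \<bullet> (R *v (s *\<^sub>R h))"
      using False by (intro u_min) (simp add: s_def)
    also have "\<dots> = s\<^sup>2 * (h \<bullet> (R *v h))"
      by (simp add: matrix_scaleR_vector_ac scaleR_matrix_vector_assoc[symmetric] power2_eq_square)
    finally have "u \<bullet> (R *v u) * (norm h)\<^sup>2 \<le> s\<^sup>2 * (h \<bullet> (R *v h)) * (norm h)\<^sup>2"
      by (rule mult_right_mono) simp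
    also have "\<dots> = (s * norm h)\<^sup>2 * (h \<bullet> (R *v h))"
      by (simp add: power_mult_distrib)
    also have "s * norm h = 1" using False by (simp add: s_def)
    finally show ?thesis by simp
  qed simp
  ultimately show ?thesis by (rule that)
qed

lemma convex_on_quadratic_form:
  fixes M :: "'a::real_inner \<Rightarrow> 'a"
  assumes "linear M" and sym: "\<And>a b. a \<bullet> M b = M a \<bullet> b" and psd: "\<And>h. 0 \<le> h \<bullet> M h"
  shows "convex_on UNIV (\<lambda>y. y \<bullet> M y)"
proof (rule convex_onI)
  fix t :: real and x y :: 'a
  assume t: "0 < t" "t < 1"
  interpret M: linear M by fact
  have "x \<bullet> M y = y \<bullet> M x" using sym[of x y] by (simp add: inner_commute)
  then have "(1 - t) * (x \<bullet> M x) + t * (y \<bullet> M y) - ((1 - t) *\<^sub>R x + t *\<^sub>R y) \<bullet> M ((1 - t) *\<^sub>R x + t *\<^sub>R y)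
      = t * (1 - t) * ((x - y) \<bullet> M (x - y))"
    by (simp add: M.add M.scale M.diff algebra_simps)
  also have "\<dots> \<ge> 0" using t psd[of "x - y"] by simp
  finally show "((1 - t) *\<^sub>R x + t *\<^sub>R y) \<bullet> M ((1 - t) *\<^sub>R x + t *\<^sub>R y) \<le> (1 - t) * (x \<bullet> M x) + t * (y \<bullet> M y)"
    by simp
qed simp

lemma convex_on_psd_mat_form: "psd_mat Q \<Longrightarrow> convex_on UNIV (\<lambda>y. y \<bullet> (Q *v y))"
  using convex_on_quadratic_form[of "(*v) Q"] by (auto simp: psd_mat_def sym_mat_inner_mult)

lemma linear_Pair: "linear f \<Longrightarrow> linear g \<Longrightarrow> linear (\<lambda>x. (f x, g x))"
  by (simp add: linear_iff)

lemma convex_on_linear_compose: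
  fixes f :: "'b::real_vector \<Rightarrow> real" and T :: "'a::real_vector \<Rightarrow> 'b"
  assumes f: "convex_on UNIV f" and "linear T"
  shows "convex_on UNIV (\<lambda>x. f (T x + c))"
proof (rule convex_onI)
  fix t :: real and x y :: 'a
  assume t: "0 < t" "t < 1"
  interpret T: linear T by fact
  have "T ((1 - t) *\<^sub>R x + t *\<^sub>R y) = (1 - t) *\<^sub>R T x + t *\<^sub>R T y"
    by (simp only: T.add T.scale)
  then have "T ((1 - t) *\<^sub>R x + t *\<^sub>R y) + c = (1 - t) *\<^sub>R (T x + c) + t *\<^sub>R (T y + c)"
    by (simp add: algebra_simps)
  then show "f (T ((1 - t) *\<^sub>R x + t *\<^sub>R y) + c) \<le> (1 - t) * f (T x + c) + t * f (T y + c)"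
    using convex_onD[OF f, of t "T x + c" "T y + c"] t by simp
qed simp

lemma convex_on_sum_functions:
  "finite I \<Longrightarrow> (\<And>i. i \<in> I \<Longrightarrow> convex_on UNIV (f i)) \<Longrightarrow> convex_on UNIV (\<lambda>x. \<Sum>i\<in>I. f i x)"
  by (induction I rule: finite_induct) (auto simp: convex_on_const convex_on_add)

lemma strongly_convex_onI:
  fixes f :: "'a::real_inner \<Rightarrow> real"
  assumes "0 < l" and convex: "convex_on UNIV (\<lambda>x. f x - l * (norm x)\<^sup>2)"
  shows "strongly_convex_on UNIV f"
  unfolding strongly_convex_on_def
proof (intro exI[of _ "2 * l"] conjI ballI)
  fix x y :: 'a and t :: real
  assume "t \<in> {0..1}"
  then have "f ((1 - t) *\<^sub>R x + t *\<^sub>R y) - l * (norm ((1 - t) *\<^sub>R x + t *\<^sub>R y))\<^sup>2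
      \<le> (1 - t) * (f x - l * (norm x)\<^sup>2) + t * (f y - l * (norm y)\<^sup>2)"
    using convex_onD[OF convex, of t x y] by simp
  moreover have "l * ((1 - t) * (norm x)\<^sup>2 + t * (norm y)\<^sup>2 - (norm ((1 - t) *\<^sub>R x + t *\<^sub>R y))\<^sup>2)
      = l * (t * (1 - t) * (norm (x - y))\<^sup>2)"
    by (simp add: power2_norm_eq_inner inner_commute[of y x] algebra_simps)
  ultimately show "f ((1 - t) *\<^sub>R x + t *\<^sub>R y) \<le> (1 - t) * f x + t * f y - 2 * l / 2 * t * (1 - t) * (norm (x - y))\<^sup>2"
    by (simp add: algebra_simps)
qed (use \<open>0 < l\<close> in simp)

section \<open>Hessian bounds\<close>

definition has_hessian_bounds ::
  "('a::euclidean_space \<Rightarrow> real) \<Rightarrow> ('a \<Rightarrow> 'a) \<Rightarrow> ('a \<Rightarrow> 'a \<Rightarrow> 'a) \<Rightarrow> real \<Rightarrow> real \<Rightarrow> bool" where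
  "has_hessian_bounds f g H \<sigma> L \<longleftrightarrow>
     (\<forall>U. (f has_derivative (\<lambda>h. g U \<bullet> h)) (at U) \<and> (g has_derivative H U) (at U)
        \<and> (\<forall>h. \<sigma> * (norm h)\<^sup>2 \<le> h \<bullet> H U h \<and> h \<bullet> H U h \<le> L * (norm h)\<^sup>2))
     \<and> (\<forall>U1 U2. norm (g U1 - g U2) \<le> L * norm (U1 - U2))"

definition hessian_bounded :: "('a::euclidean_space \<Rightarrow> real) \<Rightarrow> real \<Rightarrow> real \<Rightarrow> bool" where
  "hessian_bounded f \<sigma> L \<longleftrightarrow> 0 \<le> \<sigma> \<and> 0 \<le> L \<and> (\<exists>g H. has_hessian_bounds f g H \<sigma> L)"

lemma has_hessian_bounds_add:
  assumes "has_hessian_bounds f1 g1 H1 \<sigma>1 L1" and "has_hessian_bounds f2 g2 H2 \<sigma>2 L2"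
  shows "has_hessian_bounds (\<lambda>U. f1 U + f2 U) (\<lambda>U. g1 U + g2 U) (\<lambda>U h. H1 U h + H2 U h) (\<sigma>1 + \<sigma>2) (L1 + L2)"
  unfolding has_hessian_bounds_def
proof (intro conjI allI)
  fix U
  show "((\<lambda>U. f1 U + f2 U) has_derivative (\<lambda>h. (g1 U + g2 U) \<bullet> h)) (at U)"
    using assms unfolding has_hessian_bounds_def
    by (auto intro!: has_derivative_eq_rhs[OF has_derivative_add] simp: inner_add_left fun_eq_iff)
  show "((\<lambda>U. g1 U + g2 U) has_derivative (\<lambda>h. H1 U h + H2 U h)) (at U)"
    using assms unfolding has_hessian_bounds_def by (auto intro!: has_derivative_add)
  fix h
  have "\<sigma>1 * (norm h)\<^sup>2 \<le> h \<bullet> H1 U h" "h \<bullet> H1 U h \<le> L1 * (norm h)\<^sup>2"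
    and "\<sigma>2 * (norm h)\<^sup>2 \<le> h \<bullet> H2 U h" "h \<bullet> H2 U h \<le> L2 * (norm h)\<^sup>2"
    using assms unfolding has_hessian_bounds_def by blast+
  then show "(\<sigma>1 + \<sigma>2) * (norm h)\<^sup>2 \<le> h \<bullet> (H1 U h + H2 U h)"
    and "h \<bullet> (H1 U h + H2 U h) \<le> (L1 + L2) * (norm h)\<^sup>2"
    by (simp_all add: inner_add_right distrib_right)
next
  fix U1 U2
  have "norm (g1 U1 + g2 U1 - (g1 U2 + g2 U2)) \<le> norm (g1 U1 - g1 U2) + norm (g2 U1 - g2 U2)"
    by (metis add_diff_add norm_triangle_ineq)
  moreover have "norm (g1 U1 - g1 U2) \<le> L1 * norm (U1 - U2)" "norm (g2 U1 - g2 U2) \<le> L2 * norm (U1 - U2)"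
    using assms unfolding has_hessian_bounds_def by blast+
  ultimately show "norm (g1 U1 + g2 U1 - (g1 U2 + g2 U2)) \<le> (L1 + L2) * norm (U1 - U2)"
    by (simp add: distrib_right)
qed

lemma has_hessian_bounds_const: "has_hessian_bounds (\<lambda>U. c) (\<lambda>U. 0) (\<lambda>U h. 0) 0 0"
  unfolding has_hessian_bounds_def
  by (auto intro!: has_derivative_eq_rhs[OF has_derivative_const] simp: fun_eq_iff)

lemma has_hessian_bounds_cmult:
  assumes "has_hessian_bounds f g H \<sigma> L" and "0 \<le> c"
  shows "has_hessian_bounds (\<lambda>U. c * f U) (\<lambda>U. c *\<^sub>R g U) (\<lambda>U h. c *\<^sub>R H U h) (c * \<sigma>) (c * L)"
  unfolding has_hessian_bounds_def
proof (intro conjI allI)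
  fix U
  show "((\<lambda>U. c * f U) has_derivative (\<lambda>h. c *\<^sub>R g U \<bullet> h)) (at U)"
    using assms unfolding has_hessian_bounds_def
    by (auto intro!: has_derivative_eq_rhs[OF has_derivative_mult_right] simp: fun_eq_iff)
  show "((\<lambda>U. c *\<^sub>R g U) has_derivative (\<lambda>h. c *\<^sub>R H U h)) (at U)"
    using assms unfolding has_hessian_bounds_def by (auto intro!: has_derivative_scaleR_right)
  fix h
  have "\<sigma> * (norm h)\<^sup>2 \<le> h \<bullet> H U h" "h \<bullet> H U h \<le> L * (norm h)\<^sup>2"
    using assms by (auto simp: has_hessian_bounds_def)
  then show "c * \<sigma> * (norm h)\<^sup>2 \<le> h \<bullet> c *\<^sub>R H U h" "h \<bullet> c *\<^sub>R H U h \<le> c * L * (norm h)\<^sup>2"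
    using assms(2) by (auto simp: mult.assoc intro: mult_left_mono)
next
  fix U1 U2
  have "norm (g U1 - g U2) \<le> L * norm (U1 - U2)" using assms by (auto simp: has_hessian_bounds_def)
  then have "c * norm (g U1 - g U2) \<le> c * (L * norm (U1 - U2))" using assms(2) by (rule mult_left_mono)
  then show "norm (c *\<^sub>R g U1 - c *\<^sub>R g U2) \<le> c * L * norm (U1 - U2)"
    using assms(2) by (simp add: scaleR_diff_right[symmetric] mult.assoc)
qed

lemma has_hessian_bounds_mono:
  assumes "has_hessian_bounds f g H \<sigma> L" and "L \<le> L'"
  shows "has_hessian_bounds f g H \<sigma> L'"
proof -
  have "h \<bullet> H U h \<le> L' * (norm h)\<^sup>2" for U h
    using assms mult_right_mono[OF assms(2) zero_le_power2[of "norm h"]]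
    unfolding has_hessian_bounds_def by (meson order.trans)
  moreover have "norm (g U1 - g U2) \<le> L' * norm (U1 - U2)" for U1 U2
    using assms mult_right_mono[OF assms(2) norm_ge_zero[of "U1 - U2"]]
    unfolding has_hessian_bounds_def by (meson order.trans)
  ultimately show ?thesis using assms unfolding has_hessian_bounds_def by auto
qed

lemma lipschitz_adjoint_compose:
  fixes T :: "'a::euclidean_space \<Rightarrow> 'b::euclidean_space"
  assumes "linear T" and lipschitz: "\<And>a b. norm (g a - g b) \<le> L * norm (a - b)" and "0 \<le> L"
  shows "norm (adjoint T (g (T U1 + c)) - adjoint T (g (T U2 + c)))
    \<le> L * onorm T * onorm (adjoint T) * norm (U1 - U2)"
proof -
  have T: "bounded_linear T" using \<open>linear T\<close> by (simp add: linear_conv_bounded_linear)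
  have T': "bounded_linear (adjoint T)"
    using adjoint_linear[OF \<open>linear T\<close>] by (simp add: linear_conv_bounded_linear)
  have "norm (adjoint T (g (T U1 + c)) - adjoint T (g (T U2 + c)))
      = norm (adjoint T (g (T U1 + c) - g (T U2 + c)))"
    using T' by (simp add: linear_diff bounded_linear.linear)
  also have "\<dots> \<le> onorm (adjoint T) * norm (g (T U1 + c) - g (T U2 + c))"
    by (rule onorm[OF T'])
  also have "\<dots> \<le> onorm (adjoint T) * (L * norm (T (U1 - U2)))"
    using lipschitz[of "T U1 + c" "T U2 + c"] onorm_pos_le[OF T'] \<open>linear T\<close>
    by (intro mult_left_mono) (auto simp: linear_diff)
  also have "\<dots> \<le> onorm (adjoint T) * (L * (onorm T * norm (U1 - U2)))"
    using onorm[OF T, of "U1 - U2"] onorm_pos_le[OF T'] \<open>0 \<le> L\<close> by (intro mult_left_mono) auto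
  finally show ?thesis by (simp add: mult_ac)
qed

text \<open>The gradient and Hessian pull back along the adjoint of \<open>T\<close>; strong convexity is
  not inherited since \<open>T\<close> need not be injective.\<close>
lemma has_hessian_bounds_linear_compose:
  fixes \<phi> :: "'b::euclidean_space \<Rightarrow> real" and T :: "'a::euclidean_space \<Rightarrow> 'b"
  assumes \<phi>: "has_hessian_bounds \<phi> g H \<sigma> L" and "0 \<le> \<sigma>" and "0 \<le> L" and "linear T"
  shows "has_hessian_bounds (\<lambda>U. \<phi> (T U + c)) (\<lambda>U. adjoint T (g (T U + c)))
           (\<lambda>U h. adjoint T (H (T U + c) (T h))) 0 (L * onorm T * (onorm T + onorm (adjoint T)))"
proof -
  have T: "bounded_linear T" using \<open>linear T\<close> by (simp add: linear_conv_bounded_linear)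
  have T': "bounded_linear (adjoint T)"
    using adjoint_linear[OF \<open>linear T\<close>] by (simp add: linear_conv_bounded_linear)
  have nT: "0 \<le> onorm T" "0 \<le> onorm (adjoint T)" using T T' by (simp_all add: onorm_pos_le)
  have affine: "((\<lambda>U. T U + c) has_derivative T) (at U)" for U
    using T by (auto intro!: derivative_eq_intros bounded_linear_imp_has_derivative)
  show ?thesis
    unfolding has_hessian_bounds_def
  proof (intro conjI allI)
    fix U
    have "((\<lambda>U. \<phi> (T U + c)) has_derivative (\<lambda>h. g (T U + c) \<bullet> T h)) (at U)"
      using has_derivative_compose[OF affine] \<phi> unfolding has_hessian_bounds_def by blast
    then show "((\<lambda>U. \<phi> (T U + c)) has_derivative (\<lambda>h. adjoint T (g (T U + c)) \<bullet> h)) (at U)"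
      by (rule has_derivative_eq_rhs) (simp add: fun_eq_iff adjoint_clauses(2)[OF \<open>linear T\<close>])
    have "((\<lambda>U. g (T U + c)) has_derivative (\<lambda>h. H (T U + c) (T h))) (at U)"
      using has_derivative_compose[OF affine] \<phi> unfolding has_hessian_bounds_def by blast
    then show "((\<lambda>U. adjoint T (g (T U + c))) has_derivative (\<lambda>h. adjoint T (H (T U + c) (T h)))) (at U)"
      by (rule bounded_linear.has_derivative[OF T'])
    fix h
    have pullback: "h \<bullet> adjoint T (H (T U + c) (T h)) = T h \<bullet> H (T U + c) (T h)"
      by (simp add: adjoint_clauses(1)[OF \<open>linear T\<close>])
    show "0 * (norm h)\<^sup>2 \<le> h \<bullet> adjoint T (H (T U + c) (T h))"
      unfolding pullback using \<phi> \<open>0 \<le> \<sigma>\<close> unfolding has_hessian_bounds_def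
      by (metis mult_eq_0_iff mult_nonneg_nonneg order.trans zero_le_power2)
    have "T h \<bullet> H (T U + c) (T h) \<le> L * (norm (T h))\<^sup>2"
      using \<phi> unfolding has_hessian_bounds_def by blast
    also have "\<dots> \<le> L * (onorm T * norm h)\<^sup>2"
      using \<open>0 \<le> L\<close> onorm[OF T, of h] by (intro mult_left_mono power_mono) auto
    also have "\<dots> = L * onorm T * onorm T * (norm h)\<^sup>2"
      by (simp add: power2_eq_square)
    also have "\<dots> \<le> L * onorm T * (onorm T + onorm (adjoint T)) * (norm h)\<^sup>2"
      using \<open>0 \<le> L\<close> nT by (intro mult_right_mono mult_left_mono) auto
    finally show "h \<bullet> adjoint T (H (T U + c) (T h)) \<le> L * onorm T * (onorm T + onorm (adjoint T)) * (norm h)\<^sup>2"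
      unfolding pullback .
  next
    fix U1 U2
    have lipschitz: "norm (g a - g b) \<le> L * norm (a - b)" for a b
      using \<phi> unfolding has_hessian_bounds_def by blast
    have "L * onorm T * onorm (adjoint T) \<le> L * onorm T * (onorm T + onorm (adjoint T))"
      using \<open>0 \<le> L\<close> nT by (intro mult_left_mono) auto
    then show "norm (adjoint T (g (T U1 + c)) - adjoint T (g (T U2 + c)))
        \<le> L * onorm T * (onorm T + onorm (adjoint T)) * norm (U1 - U2)"
      by (rule order_trans[OF lipschitz_adjoint_compose[OF \<open>linear T\<close> lipschitz \<open>0 \<le> L\<close>]
            mult_right_mono[OF _ norm_ge_zero]])
  qed
qed

lemma has_hessian_bounds_quadratic_form:
  fixes M :: "'a::euclidean_space \<Rightarrow> 'a"
  assumes "linear M" and sym: "\<And>a b. a \<bullet> M b = M a \<bullet> b"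
    and lower: "\<And>h. \<sigma> * (norm h)\<^sup>2 \<le> h \<bullet> M h"
  shows "has_hessian_bounds (\<lambda>y. y \<bullet> M y) (\<lambda>y. 2 *\<^sub>R M y) (\<lambda>y h. 2 *\<^sub>R M h) (2 * \<sigma>) (2 * onorm M)"
proof -
  have M: "bounded_linear M" using \<open>linear M\<close> by (simp add: linear_conv_bounded_linear)
  have dM: "(M has_derivative M) F" for F using M by (rule bounded_linear_imp_has_derivative)
  show ?thesis
    unfolding has_hessian_bounds_def
  proof (intro conjI allI)
    fix U
    have "((\<lambda>y. y \<bullet> M y) has_derivative (\<lambda>h. U \<bullet> M h + h \<bullet> M U)) (at U)"
      by (rule has_derivative_inner[OF has_derivative_ident dM])
    moreover have "U \<bullet> M h + h \<bullet> M U = 2 *\<^sub>R M U \<bullet> h" for h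
      using sym[of U h] by (simp add: inner_commute)
    ultimately show "((\<lambda>y. y \<bullet> M y) has_derivative (\<lambda>h. 2 *\<^sub>R M U \<bullet> h)) (at U)"
      by simp
    show "((\<lambda>y. 2 *\<^sub>R M y) has_derivative (\<lambda>h. 2 *\<^sub>R M h)) (at U)"
      by (rule has_derivative_scaleR_right[OF dM])
    fix h
    show "2 * \<sigma> * (norm h)\<^sup>2 \<le> h \<bullet> 2 *\<^sub>R M h" using lower[of h] by simp
    have "h \<bullet> M h \<le> norm h * norm (M h)" by (rule norm_cauchy_schwarz)
    also have "\<dots> \<le> norm h * (onorm M * norm h)" by (rule mult_left_mono[OF onorm[OF M]]) simp
    finally show "h \<bullet> 2 *\<^sub>R M h \<le> 2 * onorm M * (norm h)\<^sup>2"
      by (simp add: power2_eq_square algebra_simps)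
  next
    fix U1 U2
    have "2 *\<^sub>R M U1 - 2 *\<^sub>R M U2 = 2 *\<^sub>R M (U1 - U2)"
      using \<open>linear M\<close> by (simp add: linear_diff scaleR_diff_right)
    then show "norm (2 *\<^sub>R M U1 - 2 *\<^sub>R M U2) \<le> 2 * onorm M * norm (U1 - U2)"
      using onorm[OF M, of "U1 - U2"] by simp
  qed
qed

lemma relaxed_barrier_gradient_lipschitz:
  fixes a :: "'a::real_inner"
  assumes "0 < \<delta>"
  shows "norm (relaxed_barrier_deriv \<delta> (a \<bullet> U1 + e) *\<^sub>R a - relaxed_barrier_deriv \<delta> (a \<bullet> U2 + e) *\<^sub>R a)
    \<le> (norm a)\<^sup>2 / \<delta>\<^sup>2 * norm (U1 - U2)"
proof -
  let ?D = "relaxed_barrier_deriv \<delta>"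
  have "norm (?D (a \<bullet> U1 + e) *\<^sub>R a - ?D (a \<bullet> U2 + e) *\<^sub>R a) = \<bar>?D (a \<bullet> U1 + e) - ?D (a \<bullet> U2 + e)\<bar> * norm a"
    by (simp add: scaleR_diff_left[symmetric])
  also have "\<dots> \<le> \<bar>a \<bullet> (U1 - U2)\<bar> / \<delta>\<^sup>2 * norm a"
    using relaxed_barrier_deriv_lipschitz[OF assms, of "a \<bullet> U1 + e" "a \<bullet> U2 + e"]
    by (intro mult_right_mono) (auto simp: inner_diff_right)
  also have "\<dots> \<le> norm a * norm (U1 - U2) / \<delta>\<^sup>2 * norm a"
    by (intro mult_right_mono divide_right_mono Cauchy_Schwarz_ineq2) auto
  finally show ?thesis by (simp add: power2_eq_square mult_ac)
qed

lemma has_hessian_bounds_relaxed_barrier_affine: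
  fixes a :: "'a::euclidean_space"
  assumes "0 < \<delta>"
  shows "has_hessian_bounds (\<lambda>y. relaxed_barrier \<delta> (a \<bullet> y + e))
     (\<lambda>y. relaxed_barrier_deriv \<delta> (a \<bullet> y + e) *\<^sub>R a)
     (\<lambda>y h. (relaxed_barrier_deriv2 \<delta> (a \<bullet> y + e) * (a \<bullet> h)) *\<^sub>R a) 0 ((norm a)\<^sup>2 / \<delta>\<^sup>2)"
  unfolding has_hessian_bounds_def
proof (intro conjI allI)
  fix U
  have affine: "((\<lambda>y. a \<bullet> y + e) has_derivative (\<lambda>h. a \<bullet> h)) (at U)"
    by (auto intro!: derivative_eq_intros)
  have "((\<lambda>y. relaxed_barrier \<delta> (a \<bullet> y + e)) has_derivative
      (\<lambda>h. relaxed_barrier_deriv \<delta> (a \<bullet> U + e) * (a \<bullet> h))) (at U)"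
    using has_derivative_compose[OF affine has_real_derivative_relaxed_barrier[OF assms,
          unfolded has_field_derivative_def]] .
  then show "((\<lambda>y. relaxed_barrier \<delta> (a \<bullet> y + e)) has_derivative
      (\<lambda>h. relaxed_barrier_deriv \<delta> (a \<bullet> U + e) *\<^sub>R a \<bullet> h)) (at U)"
    by (rule has_derivative_eq_rhs) (simp add: fun_eq_iff)
  have "((\<lambda>y. relaxed_barrier_deriv \<delta> (a \<bullet> y + e)) has_derivative
      (\<lambda>h. relaxed_barrier_deriv2 \<delta> (a \<bullet> U + e) * (a \<bullet> h))) (at U)"
    using has_derivative_compose[OF affine has_real_derivative_relaxed_barrier_deriv[OF assms,
          unfolded has_field_derivative_def]] .
  then show "((\<lambda>y. relaxed_barrier_deriv \<delta> (a \<bullet> y + e) *\<^sub>R a) has_derivative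
      (\<lambda>h. (relaxed_barrier_deriv2 \<delta> (a \<bullet> U + e) * (a \<bullet> h)) *\<^sub>R a)) (at U)"
    by (rule has_derivative_scaleR_left)
  fix h
  let ?b = "relaxed_barrier_deriv2 \<delta> (a \<bullet> U + e)"
  have b: "0 < ?b" "?b \<le> 1 / \<delta>\<^sup>2"
    using relaxed_barrier_deriv2_pos[OF assms] relaxed_barrier_deriv2_le[OF assms] by auto
  have form: "h \<bullet> (?b * (a \<bullet> h)) *\<^sub>R a = ?b * (a \<bullet> h)\<^sup>2"
    by (simp add: power2_eq_square inner_commute)
  show "0 * (norm h)\<^sup>2 \<le> h \<bullet> (?b * (a \<bullet> h)) *\<^sub>R a"
    unfolding form using b by simp
  have "(a \<bullet> h)\<^sup>2 \<le> (norm a * norm h)\<^sup>2"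
    using power_mono[OF Cauchy_Schwarz_ineq2[of a h] abs_ge_zero, of 2] by simp
  then have "?b * (a \<bullet> h)\<^sup>2 \<le> (1 / \<delta>\<^sup>2) * (norm a * norm h)\<^sup>2"
    using b by (intro mult_mono) auto
  then show "h \<bullet> (?b * (a \<bullet> h)) *\<^sub>R a \<le> (norm a)\<^sup>2 / \<delta>\<^sup>2 * (norm h)\<^sup>2"
    unfolding form by (simp add: power_mult_distrib)
next
  fix U1 U2
  show "norm (relaxed_barrier_deriv \<delta> (a \<bullet> U1 + e) *\<^sub>R a - relaxed_barrier_deriv \<delta> (a \<bullet> U2 + e) *\<^sub>R a)
      \<le> (norm a)\<^sup>2 / \<delta>\<^sup>2 * norm (U1 - U2)"
    by (rule relaxed_barrier_gradient_lipschitz[OF assms])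
qed

lemma hessian_bounded_add:
  assumes "hessian_bounded f1 \<sigma>1 L1" and "hessian_bounded f2 \<sigma>2 L2"
  shows "hessian_bounded (\<lambda>U. f1 U + f2 U) (\<sigma>1 + \<sigma>2) (L1 + L2)"
proof -
  obtain g1 H1 g2 H2 where "has_hessian_bounds f1 g1 H1 \<sigma>1 L1" and "has_hessian_bounds f2 g2 H2 \<sigma>2 L2"
    using assms unfolding hessian_bounded_def by blast
  from has_hessian_bounds_add[OF this] show ?thesis
    using assms unfolding hessian_bounded_def by auto
qed

lemma hessian_bounded_cmult:
  assumes "hessian_bounded f \<sigma> L" and "0 \<le> c"
  shows "hessian_bounded (\<lambda>U. c * f U) (c * \<sigma>) (c * L)"
proof -
  obtain g H where "has_hessian_bounds f g H \<sigma> L"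
    using assms unfolding hessian_bounded_def by blast
  from has_hessian_bounds_cmult[OF this \<open>0 \<le> c\<close>] show ?thesis
    using assms unfolding hessian_bounded_def by auto
qed

lemma hessian_bounded_mono:
  assumes "hessian_bounded f \<sigma> L" and "L \<le> L'"
  shows "hessian_bounded f \<sigma> L'"
proof -
  obtain g H where "has_hessian_bounds f g H \<sigma> L"
    using assms unfolding hessian_bounded_def by blast
  from has_hessian_bounds_mono[OF this \<open>L \<le> L'\<close>] show ?thesis
    using assms unfolding hessian_bounded_def by auto
qed

lemma hessian_bounded_linear_compose:
  fixes T :: "'a::euclidean_space \<Rightarrow> 'b::euclidean_space"
  assumes "hessian_bounded \<phi> \<sigma> L" and "linear T"
  shows "hessian_bounded (\<lambda>U. \<phi> (T U + c)) 0 (L * onorm T * (onorm T + onorm (adjoint T)))"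
proof -
  have "0 \<le> onorm T" "0 \<le> onorm (adjoint T)"
    using \<open>linear T\<close> adjoint_linear[OF \<open>linear T\<close>] by (simp_all add: linear_conv_bounded_linear onorm_pos_le)
  moreover obtain g H where "has_hessian_bounds \<phi> g H \<sigma> L"
    using assms unfolding hessian_bounded_def by blast
  ultimately show ?thesis
    using has_hessian_bounds_linear_compose[of \<phi> g H \<sigma> L T c] assms unfolding hessian_bounded_def by auto
qed

lemma hessian_bounded_sum:
  assumes "finite I" and "\<And>i. i \<in> I \<Longrightarrow> \<exists>L. hessian_bounded (f i) 0 L"
  shows "\<exists>L. hessian_bounded (\<lambda>U. \<Sum>i\<in>I. f i U) 0 L"
  using assms
proof (induction I rule: finite_induct)
  case empty
  then show ?case using has_hessian_bounds_const unfolding hessian_bounded_def by auto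
next
  case (insert i I)
  then show ?case using hessian_bounded_add[of "f i" 0 _ _ 0] by fastforce
qed

lemma hessian_bounded_psd_mat_form:
  assumes "psd_mat Q"
  shows "hessian_bounded (\<lambda>y. y \<bullet> (Q *v y)) 0 (2 * onorm ((*v) Q))"
proof -
  have "has_hessian_bounds (\<lambda>y. y \<bullet> (Q *v y)) (\<lambda>y. 2 *\<^sub>R (Q *v y)) (\<lambda>y h. 2 *\<^sub>R (Q *v h))
      (2 * 0) (2 * onorm ((*v) Q))"
    by (rule has_hessian_bounds_quadratic_form) (use assms in \<open>auto simp: psd_mat_def sym_mat_inner_mult\<close>)
  then show ?thesis unfolding hessian_bounded_def by (auto simp: onorm_matrix_nonneg)
qed

section \<open>Recentred barriers\<close>

locale recentred_barrier =
  fixes \<delta> :: real and C :: "real^'k^'q::finite" and d w :: "real^'q"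
  assumes delta_pos: "0 < \<delta>" and delta_le: "\<And>i. \<delta> \<le> d $ i" and weights_nonneg: "\<And>i. 0 \<le> w $ i"
    and centered: "transpose C *v (\<chi> i. (1 + w $ i) / d $ i) = 0"
begin

abbreviation M :: "real^'k^'k" where
  "M \<equiv> (1 / (2 * \<delta>\<^sup>2)) *\<^sub>R (transpose C ** diag_mat (1 + w) ** C)"

lemma rec_barrier_eq_sum_excess:
  "rec_barrier \<delta> C d w y = (\<Sum>i\<in>UNIV. (1 + w $ i) * barrier_excess \<delta> (d $ i) (C $ i \<bullet> y))"
proof -
  have "(\<Sum>i\<in>UNIV. (1 + w $ i) * ((C $ i \<bullet> y) / d $ i)) = (C *v y) \<bullet> (\<chi> i. (1 + w $ i) / d $ i)"
    by (simp add: inner_vec_def matrix_vector_mul_component mult.commute)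
  also have "\<dots> = y \<bullet> (transpose C *v (\<chi> i. (1 + w $ i) / d $ i))"
    by (rule inner_transpose_mult[symmetric])
  also have "\<dots> = 0"
    using centered by simp
  finally have linear_parts: "(\<Sum>i\<in>UNIV. (1 + w $ i) * ((C $ i \<bullet> y) / d $ i)) = 0" .
  have "rec_barrier \<delta> C d w y = (\<Sum>i\<in>UNIV. (1 + w $ i) * barrier_excess \<delta> (d $ i) (C $ i \<bullet> y)
      + (1 + w $ i) * ((C $ i \<bullet> y) / d $ i))"
    unfolding rec_barrier_def barrier_excess_def by (simp add: algebra_simps)
  with linear_parts show ?thesis by (simp add: sum.distrib)
qed

lemma rec_barrier_nonneg: "0 \<le> rec_barrier \<delta> C d w y"
  unfolding rec_barrier_eq_sum_excess
  using weights_nonneg barrier_excess_nonneg[OF delta_pos delta_le]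
  by (intro sum_nonneg mult_nonneg_nonneg) (auto intro: add_nonneg_nonneg)

lemma rec_barrier_le_quadratic: "rec_barrier \<delta> C d w y \<le> y \<bullet> (M *v y)"
proof -
  have "rec_barrier \<delta> C d w y \<le> (\<Sum>i\<in>UNIV. (1 + w $ i) * ((C $ i \<bullet> y)\<^sup>2 / (2 * \<delta>\<^sup>2)))"
    unfolding rec_barrier_eq_sum_excess
    using weights_nonneg barrier_excess_le[OF delta_pos delta_le]
    by (intro sum_mono mult_left_mono) (auto intro: add_nonneg_nonneg)
  also have "\<dots> = y \<bullet> (M *v y)"
    by (simp add: scaleR_matrix_vector_assoc[symmetric] quadratic_form_weighted_rows sum_distrib_left
        field_simps)
  finally show ?thesis .
qed

lemma rec_barrier_ge_row:
  assumes "\<And>i. d $ i \<le> D"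
  shows "quad_lin \<bar>C $ k \<bullet> y\<bar> / (2 * (D + 1)\<^sup>2) \<le> rec_barrier \<delta> C d w y"
proof -
  have "quad_lin \<bar>C $ k \<bullet> y\<bar> / (2 * (D + 1)\<^sup>2) \<le> barrier_excess \<delta> (d $ k) (C $ k \<bullet> y)"
    using delta_pos delta_le assms by (rule barrier_excess_ge)
  also have "\<dots> \<le> (1 + w $ k) * barrier_excess \<delta> (d $ k) (C $ k \<bullet> y)"
    using weights_nonneg[of k] barrier_excess_nonneg[OF delta_pos delta_le, of k] by (simp add: algebra_simps)
  also have "\<dots> \<le> (\<Sum>i\<in>UNIV. (1 + w $ i) * barrier_excess \<delta> (d $ i) (C $ i \<bullet> y))"
    using weights_nonneg barrier_excess_nonneg[OF delta_pos delta_le]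
    by (intro member_le_sum) (auto intro: mult_nonneg_nonneg add_nonneg_nonneg)
  finally show ?thesis unfolding rec_barrier_eq_sum_excess .
qed

lemma convex_on_rec_barrier: "convex_on UNIV (rec_barrier \<delta> C d w)"
proof -
  have "convex_on UNIV (\<lambda>y. relaxed_barrier \<delta> ((- C $ i) \<bullet> y + d $ i))" for i
    using convex_on_linear_compose[OF convex_on_relaxed_barrier[OF delta_pos]
        bounded_linear_inner_right[THEN bounded_linear.linear]] .
  then show ?thesis
    unfolding rec_barrier_def[abs_def] using weights_nonneg
    by (intro convex_on_sum_functions convex_on_cmul convex_on_add)
       (auto simp: convex_on_const)
qed

lemma hessian_bounded_rec_barrier: "\<exists>L. hessian_bounded (rec_barrier \<delta> C d w) 0 L"
proof -
  have "hessian_bounded (\<lambda>y. (1 + w $ i) * (relaxed_barrier \<delta> ((- C $ i) \<bullet> y + d $ i) + ln (d $ i)))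
      0 ((1 + w $ i) * ((norm (- C $ i))\<^sup>2 / \<delta>\<^sup>2 + 0))" for i
  proof -
    have "hessian_bounded (\<lambda>y. relaxed_barrier \<delta> ((- C $ i) \<bullet> y + d $ i)) 0 ((norm (- C $ i))\<^sup>2 / \<delta>\<^sup>2)"
      using has_hessian_bounds_relaxed_barrier_affine[OF delta_pos, of "- C $ i" "d $ i"]
      unfolding hessian_bounded_def by auto
    moreover have "hessian_bounded (\<lambda>y. ln (d $ i)) 0 0"
      using has_hessian_bounds_const unfolding hessian_bounded_def by auto
    ultimately have "hessian_bounded (\<lambda>y. relaxed_barrier \<delta> ((- C $ i) \<bullet> y + d $ i) + ln (d $ i))
        (0 + 0) ((norm (- C $ i))\<^sup>2 / \<delta>\<^sup>2 + 0)"
      by (rule hessian_bounded_add)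
    from hessian_bounded_cmult[OF this, of "1 + w $ i"] show ?thesis
      using weights_nonneg[of i] by simp
  qed
  then have "\<exists>L. hessian_bounded
      (\<lambda>y. \<Sum>i\<in>UNIV. (1 + w $ i) * (relaxed_barrier \<delta> ((- C $ i) \<bullet> y + d $ i) + ln (d $ i))) 0 L"
    by (intro hessian_bounded_sum) auto
  then show ?thesis unfolding rec_barrier_def[abs_def] by auto
qed

end

section \<open>Stacked inputs and trajectories\<close>

lemma length_enum: "length (enum_class.enum :: 'N::enum list) = CARD('N)"
  by (simp add: card_UNIV_length_enum)

lemma blk_idx_enum_nth:
  assumes "k < CARD('N::enum)"
  shows "blk_idx (enum_class.enum ! k :: 'N) = k"
proof -
  have "distinct (enum_class.enum :: 'N list)" by (rule enum_distinct)
  then show ?thesis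
    unfolding blk_idx_def
    by (intro the_equality) (use assms length_enum[where 'N = 'N] in \<open>auto simp: nth_eq_iff_index_eq\<close>)
qed

lemma sum_UNIV_enum_nth: "(\<Sum>j\<in>UNIV. F j) = (\<Sum>k<CARD('N::enum). F (enum_class.enum ! k :: 'N))"
proof -
  have "bij_betw ((!) (enum_class.enum :: 'N list)) {..<CARD('N)} UNIV"
    by (rule bij_betw_nth) (auto simp: enum_distinct length_enum UNIV_enum)
  then show ?thesis by (simp add: sum.reindex_bij_betw)
qed

lemma blk_shift_in:
  assumes "k < CARD('N)"
  shows "blk (shift_in (U :: real^'m^'N::enum) v) k = (if k + 1 < CARD('N) then blk U (k + 1) else v)"
  using assms by (simp add: blk_def shift_in_def blk_idx_enum_nth)

lemma blk_add: "blk (U1 + U2) = (\<lambda>k. blk U1 k + blk U2 k)"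
  by (simp add: blk_def fun_eq_iff)

lemma blk_scaleR: "blk (c *\<^sub>R U) = (\<lambda>k. c *\<^sub>R blk U k)"
  by (simp add: blk_def fun_eq_iff)

lemma blk_zero: "blk 0 = (\<lambda>k. 0)"
  by (simp add: blk_def fun_eq_iff)

lemma linear_blk: "linear (\<lambda>U :: real^'m^'N::enum. blk U k)"
  by (rule linearI) (simp_all add: blk_add blk_scaleR)

lemma norm_blk_le: "norm (blk (U :: real^'m^'N::enum) k) \<le> norm U"
  unfolding blk_def by (rule Finite_Cartesian_Product.norm_nth_le)

lemma traj_add: "traj A B (x1 + x2) (\<lambda>j. u1 j + u2 j) k = traj A B x1 u1 k + traj A B x2 u2 k"
  by (induction k) (simp_all add: algebra_simps)

lemma traj_scaleR: "traj A B (c *\<^sub>R x) (\<lambda>j. c *\<^sub>R u j) k = c *\<^sub>R traj A B x u k"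
  by (induction k) (simp_all add: matrix_scaleR_vector_ac scaleR_matrix_vector_assoc algebra_simps)

lemma traj_zero: "traj A B 0 (\<lambda>j. 0) k = 0"
  by (induction k) simp_all

lemma traj_cong: "(\<And>j. j < k \<Longrightarrow> u j = u' j) \<Longrightarrow> traj A B x u k = traj A B x u' k"
  by (induction k) auto

lemma traj_shift: "traj A B (A *v x + B *v u 0) (\<lambda>j. u (Suc j)) k = traj A B x u (Suc k)"
  by (induction k) auto

lemma linear_traj:
  "linear (\<lambda>w :: (real^'m^'N::enum) \<times> (real^'n). traj A B (snd w) (blk (fst w)) k)"
  by (rule linearI) (simp_all add: blk_add blk_scaleR traj_add traj_scaleR)

definition blockdiag :: "real^'m^'m \<Rightarrow> real^'m^'N \<Rightarrow> real^'m^'N" where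
  "blockdiag R U = (\<chi> j. R *v U $ j)"

lemma linear_blockdiag: "linear (blockdiag R)"
  by (rule linearI)
     (simp_all add: blockdiag_def vec_eq_iff matrix_vector_right_distrib matrix_scaleR_vector_ac
       scaleR_matrix_vector_assoc)

lemma inner_blockdiag: "a \<bullet> blockdiag R b = (\<Sum>j\<in>UNIV. a $ j \<bullet> (R *v b $ j))"
  by (simp add: blockdiag_def inner_vec_def)

lemma blockdiag_symmetric:
  assumes "sym_mat R"
  shows "a \<bullet> blockdiag R b = blockdiag R a \<bullet> b"
proof -
  have "blockdiag R a \<bullet> b = (\<Sum>j\<in>UNIV. (R *v a $ j) \<bullet> b $ j)"
    unfolding blockdiag_def by (subst inner_vec_def) simp
  then show ?thesis by (simp add: inner_blockdiag sym_mat_inner_mult[OF assms])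
qed

lemma blockdiag_coercive:
  assumes "\<And>h. l * (norm h)\<^sup>2 \<le> h \<bullet> (R *v h)"
  shows "l * (norm U)\<^sup>2 \<le> U \<bullet> blockdiag R U"
proof -
  have "l * (norm U)\<^sup>2 = (\<Sum>j\<in>UNIV. l * (norm (U $ j))\<^sup>2)"
    by (simp add: power2_norm_eq_inner inner_vec_def sum_distrib_left)
  also have "\<dots> \<le> (\<Sum>j\<in>UNIV. U $ j \<bullet> (R *v U $ j))"
    by (rule sum_mono) (rule assms)
  finally show ?thesis by (simp add: inner_blockdiag)
qed

lemma sum_blk_quadratic_form:
  "(\<Sum>k<CARD('N). blk U k \<bullet> (R *v blk U k)) = (U :: real^'m^'N::enum) \<bullet> blockdiag R U"
  by (simp add: inner_blockdiag sum_UNIV_enum_nth[where F = "\<lambda>j. U $ j \<bullet> (R *v U $ j)"] blk_def)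

section \<open>Comparison functions\<close>

lemma K_inf_scaled_square:
  assumes "0 < c"
  shows "K_inf (\<lambda>r. c * r\<^sup>2)"
  unfolding K_inf_def
proof (intro conjI allI impI)
  show "continuous_on {0..} (\<lambda>r. c * r\<^sup>2)" by (intro continuous_intros)
  show "strict_mono_on {0..} (\<lambda>r. c * r\<^sup>2)"
    by (rule strict_mono_onI) (use assms in \<open>auto intro!: mult_strict_left_mono power_strict_mono\<close>)
  show "0 \<le> c * s\<^sup>2" for s using assms by simp
  show "filterlim (\<lambda>r. c * r\<^sup>2) at_top at_top"
    using assms by (intro filterlim_tendsto_pos_mult_at_top filterlim_pow_at_top filterlim_ident) auto
qed simp

lemma K_inf_scaled_quad_lin:
  assumes "0 < c"
  shows "K_inf (\<lambda>r. c * quad_lin r)"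
  unfolding K_inf_def
proof (intro conjI allI impI)
  show "continuous_on {0..} (\<lambda>r. c * quad_lin r)"
    unfolding quad_lin_def by (intro continuous_intros)
  show "strict_mono_on {0..} (\<lambda>r. c * quad_lin r)"
  proof (rule strict_mono_onI)
    fix r s :: real
    assume "r \<in> {0..}" "s \<in> {0..}" "r < s"
    then have "r\<^sup>2 < s\<^sup>2" by (auto intro: power_strict_mono)
    with \<open>r < s\<close> assms show "c * quad_lin r < c * quad_lin s" by (auto simp: quad_lin_def min_def)
  qed
  show "0 \<le> c * quad_lin s" if "0 \<le> s" for s
    using assms that by (simp add: quad_lin_nonneg)
  have "\<forall>\<^sub>F r in at_top. r = quad_lin r"
    using eventually_ge_at_top[of 1] by eventually_elim (auto simp: quad_lin_def min_def power2_eq_square)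
  then show "filterlim (\<lambda>r. c * quad_lin r) at_top at_top"
    using assms by (intro filterlim_tendsto_pos_mult_at_top)
      (auto intro: filterlim_cong[THEN iffD1, OF refl refl _ filterlim_ident])
qed (simp add: quad_lin_def)

text \<open>Split on which of the two norms carries half of \<open>r\<close>.\<close>
lemma quad_lin_le_split:
  fixes l e k a b r :: real
  assumes "0 < l" "0 < e" "0 < k" "0 \<le> a" "0 \<le> b" "0 \<le> r" "r \<le> a + b"
  shows "min (l / 4) (e / (max 1 (2 * k))\<^sup>2) * quad_lin r \<le> l * a\<^sup>2 + e * quad_lin (b / k)"
proof -
  let ?c = "max 1 (2 * k)"
  have "1 \<le> ?c" by simp
  have terms_nonneg: "0 \<le> l * a\<^sup>2" "0 \<le> e * quad_lin (b / k)"
    using assms by (simp_all add: quad_lin_nonneg)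
  have "0 \<le> quad_lin r" using assms by (simp add: quad_lin_nonneg)
  show ?thesis
  proof (cases "r / 2 \<le> a")
    case True
    have "min (l / 4) (e / ?c\<^sup>2) * quad_lin r \<le> (l / 4) * quad_lin r"
      by (rule mult_right_mono[OF min.cobounded1 \<open>0 \<le> quad_lin r\<close>])
    also have "\<dots> \<le> (l / 4) * r\<^sup>2"
      using quad_lin_le_square[OF \<open>0 \<le> r\<close>] assms by (intro mult_left_mono) auto
    also have "\<dots> = l * (r / 2)\<^sup>2" by (simp add: power_divide)
    also have "\<dots> \<le> l * a\<^sup>2" using True assms by (intro mult_left_mono power_mono) auto
    finally show ?thesis using terms_nonneg by simp
  next
    case False
    have "r / ?c \<le> r / (2 * k)" using assms by (intro divide_left_mono) auto
    also have "\<dots> \<le> b / k" using False assms by (simp add: field_simps)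
    finally have "r / ?c \<le> b / k" .
    have "min (l / 4) (e / ?c\<^sup>2) * quad_lin r \<le> e / ?c\<^sup>2 * quad_lin r"
      by (rule mult_right_mono[OF min.cobounded2 \<open>0 \<le> quad_lin r\<close>])
    also have "\<dots> = e * (quad_lin r / ?c\<^sup>2)" by simp
    also have "\<dots> \<le> e * quad_lin (r / ?c)"
      using assms \<open>1 \<le> ?c\<close> by (intro mult_left_mono quad_lin_divide_ge) auto
    also have "\<dots> \<le> e * quad_lin (b / k)"
      using assms \<open>1 \<le> ?c\<close> \<open>r / ?c \<le> b / k\<close> by (intro mult_left_mono quad_lin_mono) auto
    finally show ?thesis using terms_nonneg by simp
  qed
qed

text \<open>If all row values of \<open>x\<close> were \<open>\<le> 0\<close>, the whole ray through \<open>x\<close> would lie in the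
  compact polytope; so some row value is positive, and scaling \<open>x\<close> until it hits the boundary
  bounds its norm.\<close>
lemma compact_polytope_norm_le_row:
  fixes C :: "real^'n^'q::finite" and d :: "real^'q"
  assumes "compact {x. \<forall>i. (C *v x) $ i \<le> d $ i}" and "\<And>i. 0 < d $ i"
  obtains \<kappa> where "0 < \<kappa>" and "\<And>x. \<exists>i. norm x \<le> \<kappa> * \<bar>C $ i \<bullet> x\<bar>"
proof -
  let ?X = "{x. \<forall>i. (C *v x) $ i \<le> d $ i}"
  obtain \<rho> where "0 < \<rho>" and \<rho>: "\<And>y. y \<in> ?X \<Longrightarrow> norm y \<le> \<rho>"
    using compact_imp_bounded[OF assms(1)] unfolding bounded_pos by blast
  define dmin where "dmin = Min (range (\<lambda>i. d $ i))"
  have dmin_le: "dmin \<le> d $ i" for i unfolding dmin_def by (rule Min_le) auto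
  have "0 < dmin" unfolding dmin_def using assms(2) by (subst Min_gr_iff) auto
  have "\<exists>i. norm x \<le> (\<rho> / dmin) * \<bar>C $ i \<bullet> x\<bar>" for x
  proof -
    obtain i where i_max: "\<And>j. \<bar>C $ j \<bullet> x\<bar> \<le> \<bar>C $ i \<bullet> x\<bar>"
    proof -
      have "Max (range (\<lambda>j. \<bar>C $ j \<bullet> x\<bar>)) \<in> range (\<lambda>j. \<bar>C $ j \<bullet> x\<bar>)" by (rule Max_in) auto
      then obtain i where "Max (range (\<lambda>j. \<bar>C $ j \<bullet> x\<bar>)) = \<bar>C $ i \<bullet> x\<bar>" by blast
      moreover have "\<bar>C $ j \<bullet> x\<bar> \<le> Max (range (\<lambda>j. \<bar>C $ j \<bullet> x\<bar>))" for j by (rule Max_ge) auto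
      ultimately show ?thesis using that by metis
    qed
    let ?m = "\<bar>C $ i \<bullet> x\<bar>"
    have scaled_in: "t *\<^sub>R x \<in> ?X" if "0 \<le> t" "t * ?m \<le> dmin" for t
    proof (clarify)
      fix j
      have "(C *v (t *\<^sub>R x)) $ j = t * (C $ j \<bullet> x)" by (simp add: matrix_vector_mul_component)
      also have "\<dots> \<le> t * ?m" using i_max[of j] that(1) by (intro mult_left_mono) auto
      also have "\<dots> \<le> d $ j" using that(2) dmin_le[of j] by simp
      finally show "(C *v (t *\<^sub>R x)) $ j \<le> d $ j" .
    qed
    show ?thesis
    proof (cases "?m = 0")
      case True
      have "norm (((\<rho> + 1) / norm x) *\<^sub>R x) \<le> \<rho>" if "x \<noteq> 0"
        using scaled_in[of "(\<rho> + 1) / norm x"] True \<open>0 < \<rho>\<close> \<open>0 < dmin\<close> by (intro \<rho>) simp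
      then have "x = 0" using \<open>0 < \<rho>\<close> by (cases "x = 0") auto
      then show ?thesis by simp
    next
      case False
      then have "0 < ?m" by simp
      have "norm ((dmin / ?m) *\<^sub>R x) \<le> \<rho>"
        using scaled_in[of "dmin / ?m"] \<open>0 < ?m\<close> \<open>0 < dmin\<close> by (intro \<rho>) simp
      then have "norm x \<le> (\<rho> / dmin) * ?m"
        using \<open>0 < ?m\<close> \<open>0 < dmin\<close> by (simp add: field_simps)
      then show ?thesis by blast
    qed
  qed
  with \<open>0 < \<rho>\<close> \<open>0 < dmin\<close> show ?thesis by (intro that[of "\<rho> / dmin"]) auto
qed

section \<open>The relaxed barrier MPC cost\<close>

locale relaxed_barrier_mpc =
  state: recentred_barrier \<delta> Cx dx wx + input: recentred_barrier \<delta> Cu du wu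
  for \<delta> :: real and Cx :: "real^'n^'qx::finite" and dx wx :: "real^'qx"
    and Cu :: "real^'m^'qu::finite" and du wu :: "real^'qu" +
  fixes A :: "real^'n^'n" and B :: "real^'m^'n" and Q P :: "real^'n^'n" and R :: "real^'m^'m"
    and \<epsilon> :: real
  assumes eps_pos: "0 < \<epsilon>" and Q_psd: "psd_mat Q" and R_pd: "pd_mat R" and P_pd: "pd_mat P"
begin

abbreviation stage :: "real^'n \<Rightarrow> real^'m \<Rightarrow> real" where
  "stage \<equiv> stage_cost Q R \<epsilon> \<delta> Cx dx wx Cu du wu"

abbreviation J :: "real^'m^'N::enum \<Rightarrow> real^'n \<Rightarrow> real" where
  "J \<equiv> mpc_cost A B Q R P \<epsilon> \<delta> Cx dx wx Cu du wu"

text \<open>The cost without the input weight \<open>R\<close>, which alone carries the strong convexity in the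
  inputs; as a function of the pair \<open>(U, x)\<close> it is convex with bounded Hessian.\<close>
definition reduced_stage :: "(real^'n) \<times> (real^'m) \<Rightarrow> real" where
  "reduced_stage z = fst z \<bullet> (Q *v fst z) + \<epsilon> * rec_barrier \<delta> Cx dx wx (fst z) + \<epsilon> * rec_barrier \<delta> Cu du wu (snd z)"

definition reduced_cost :: "(real^'m^'N::enum) \<times> (real^'n) \<Rightarrow> real" where
  "reduced_cost w =
     (\<Sum>k<CARD('N). reduced_stage (traj A B (snd w) (blk (fst w)) k, blk (fst w) k))
     + traj A B (snd w) (blk (fst w)) CARD('N) \<bullet> (P *v traj A B (snd w) (blk (fst w)) CARD('N))"

lemma mpc_cost_eq_reduced_cost: "J U x = reduced_cost (U, x) + U \<bullet> blockdiag R U"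
  unfolding mpc_cost_def reduced_cost_def reduced_stage_def stage_cost_def sum_blk_quadratic_form[symmetric]
  by (simp add: sum.distrib algebra_simps)

lemma linear_stage_arguments:
  "linear (\<lambda>w :: (real^'m^'N::enum) \<times> (real^'n). (traj A B (snd w) (blk (fst w)) k, blk (fst w) k))"
  using linear_traj linear_blk[THEN linear_compose[OF bounded_linear_fst[THEN bounded_linear.linear]]]
  by (intro linear_Pair) (auto simp: o_def)

lemma convex_on_reduced_cost: "convex_on UNIV (reduced_cost :: (real^'m^'N::enum) \<times> (real^'n) \<Rightarrow> real)"
proof -
  have convex_fst: "convex_on UNIV (\<lambda>z :: (real^'n) \<times> (real^'m). f (fst z))"
    if "convex_on UNIV f" for f
    using convex_on_linear_compose[OF that bounded_linear_fst[THEN bounded_linear.linear], where c = 0] by simp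
  have convex_snd: "convex_on UNIV (\<lambda>z :: (real^'n) \<times> (real^'m). f (snd z))"
    if "convex_on UNIV f" for f
    using convex_on_linear_compose[OF that bounded_linear_snd[THEN bounded_linear.linear], where c = 0] by simp
  have "convex_on UNIV reduced_stage"
    unfolding reduced_stage_def[abs_def] using eps_pos
    by (intro convex_on_add convex_on_cmul convex_fst convex_snd convex_on_psd_mat_form Q_psd
        state.convex_on_rec_barrier input.convex_on_rec_barrier) auto
  then have "convex_on UNIV (\<lambda>w :: (real^'m^'N::enum) \<times> (real^'n).
      reduced_stage (traj A B (snd w) (blk (fst w)) k, blk (fst w) k))" for k
    using convex_on_linear_compose[OF _ linear_stage_arguments, where c = 0] by simp
  moreover have "convex_on UNIV (\<lambda>w :: (real^'m^'N::enum) \<times> (real^'n).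
      traj A B (snd w) (blk (fst w)) CARD('N) \<bullet> (P *v traj A B (snd w) (blk (fst w)) CARD('N)))"
    using convex_on_linear_compose[OF convex_on_psd_mat_form[OF pd_mat_imp_psd_mat[OF P_pd]] linear_traj,
        where c = 0] by simp
  ultimately show ?thesis
    unfolding reduced_cost_def[abs_def] by (intro convex_on_add convex_on_sum_functions) auto
qed

lemma hessian_bounded_reduced_cost:
  "\<exists>L. hessian_bounded (reduced_cost :: (real^'m^'N::enum) \<times> (real^'n) \<Rightarrow> real) 0 L"
proof -
  have bounded_fst: "\<exists>L'. hessian_bounded (\<lambda>z :: (real^'n) \<times> (real^'m). f (fst z)) 0 L'"
    if "hessian_bounded f 0 L" for f L
    using hessian_bounded_linear_compose[OF that bounded_linear_fst[THEN bounded_linear.linear], where c = 0] by auto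
  have bounded_snd: "\<exists>L'. hessian_bounded (\<lambda>z :: (real^'n) \<times> (real^'m). f (snd z)) 0 L'"
    if "hessian_bounded f 0 L" for f L
    using hessian_bounded_linear_compose[OF that bounded_linear_snd[THEN bounded_linear.linear], where c = 0] by auto
  obtain Lx Lu where "hessian_bounded (rec_barrier \<delta> Cx dx wx) 0 Lx" "hessian_bounded (rec_barrier \<delta> Cu du wu) 0 Lu"
    using state.hessian_bounded_rec_barrier input.hessian_bounded_rec_barrier by blast
  then have "hessian_bounded (\<lambda>y. \<epsilon> * rec_barrier \<delta> Cx dx wx y) 0 (\<epsilon> * Lx)"
    "hessian_bounded (\<lambda>u. \<epsilon> * rec_barrier \<delta> Cu du wu u) 0 (\<epsilon> * Lu)"
    using hessian_bounded_cmult eps_pos by fastforce+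
  then obtain L1 L2 L3 where
    "hessian_bounded (\<lambda>z :: (real^'n) \<times> (real^'m). fst z \<bullet> (Q *v fst z)) 0 L1"
    "hessian_bounded (\<lambda>z :: (real^'n) \<times> (real^'m). \<epsilon> * rec_barrier \<delta> Cx dx wx (fst z)) 0 L2"
    "hessian_bounded (\<lambda>z :: (real^'n) \<times> (real^'m). \<epsilon> * rec_barrier \<delta> Cu du wu (snd z)) 0 L3"
    using bounded_fst[OF hessian_bounded_psd_mat_form[OF Q_psd]] bounded_fst bounded_snd by meson
  then have "hessian_bounded reduced_stage (0 + 0 + 0) (L1 + L2 + L3)"
    unfolding reduced_stage_def[abs_def] by (intro hessian_bounded_add)
  then obtain Ls where stage_bounded: "hessian_bounded reduced_stage 0 Ls" by auto
  have "\<exists>L. hessian_bounded (\<lambda>w :: (real^'m^'N::enum) \<times> (real^'n).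
      \<Sum>k<CARD('N). reduced_stage (traj A B (snd w) (blk (fst w)) k, blk (fst w) k)) 0 L"
    using hessian_bounded_linear_compose[OF stage_bounded linear_stage_arguments, where c = 0]
    by (intro hessian_bounded_sum) auto
  moreover have "\<exists>L. hessian_bounded (\<lambda>w :: (real^'m^'N::enum) \<times> (real^'n).
      traj A B (snd w) (blk (fst w)) CARD('N) \<bullet> (P *v traj A B (snd w) (blk (fst w)) CARD('N))) 0 L"
    using hessian_bounded_linear_compose[OF hessian_bounded_psd_mat_form[OF pd_mat_imp_psd_mat[OF P_pd]]
        linear_traj, where c = 0] by auto
  ultimately obtain L1 L2 where
    "hessian_bounded (\<lambda>w :: (real^'m^'N::enum) \<times> (real^'n).
      \<Sum>k<CARD('N). reduced_stage (traj A B (snd w) (blk (fst w)) k, blk (fst w) k)) 0 L1"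
    "hessian_bounded (\<lambda>w :: (real^'m^'N::enum) \<times> (real^'n).
      traj A B (snd w) (blk (fst w)) CARD('N) \<bullet> (P *v traj A B (snd w) (blk (fst w)) CARD('N))) 0 L2"
    by blast
  then have "hessian_bounded (reduced_cost :: (real^'m^'N::enum) \<times> (real^'n) \<Rightarrow> real) (0 + 0) (L1 + L2)"
    unfolding reduced_cost_def[abs_def] by (rule hessian_bounded_add)
  then show ?thesis by auto
qed

lemma convex_on_mpc_cost_state: "convex_on UNIV (\<lambda>x. J (U :: real^'m^'N::enum) x)"
proof -
  have "convex_on UNIV (\<lambda>x. reduced_cost ((0, x) + (U, 0)))"
    by (rule convex_on_linear_compose[OF convex_on_reduced_cost]) (simp add: linear_iff)
  then have "convex_on UNIV (\<lambda>x. reduced_cost (U, x) + U \<bullet> blockdiag R U)"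
    by (intro convex_on_add) (simp_all add: convex_on_const)
  then show ?thesis by (simp add: mpc_cost_eq_reduced_cost)
qed

lemma strongly_convex_on_mpc_cost_inputs:
  "strongly_convex_on UNIV (\<lambda>U :: real^'m^'N::enum. J U x)"
proof -
  obtain l where "0 < l" and l: "\<And>h. l * (norm h)\<^sup>2 \<le> h \<bullet> (R *v h)"
    using pd_mat_coercive[OF R_pd] by blast
  have sym_R: "sym_mat R" using R_pd by (simp add: pd_mat_def)
  have "convex_on UNIV (\<lambda>U :: real^'m^'N::enum. U \<bullet> (blockdiag R U - l *\<^sub>R U))"
  proof (rule convex_on_quadratic_form)
    show "linear (\<lambda>U :: real^'m^'N::enum. blockdiag R U - l *\<^sub>R U)"
      by (intro linear_compose_sub linear_blockdiag linear_scaleR)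
    show "a \<bullet> (blockdiag R b - l *\<^sub>R b) = (blockdiag R a - l *\<^sub>R a) \<bullet> b" for a b :: "real^'m^'N::enum"
      by (simp add: inner_diff_left inner_diff_right blockdiag_symmetric[OF sym_R])
    show "0 \<le> h \<bullet> (blockdiag R h - l *\<^sub>R h)" for h :: "real^'m^'N::enum"
      using blockdiag_coercive[OF l, of h] by (simp add: inner_diff_right power2_norm_eq_inner)
  qed
  moreover have "convex_on UNIV (\<lambda>U :: real^'m^'N::enum. reduced_cost ((U, 0) + (0, x)))"
    by (rule convex_on_linear_compose[OF convex_on_reduced_cost]) (simp add: linear_iff)
  ultimately have convex_sum: "convex_on UNIV (\<lambda>U :: real^'m^'N::enum.
      U \<bullet> (blockdiag R U - l *\<^sub>R U) + reduced_cost ((U, 0) + (0, x)))"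
    by (rule convex_on_add)
  have sum_eq: "(\<lambda>U :: real^'m^'N::enum. U \<bullet> (blockdiag R U - l *\<^sub>R U) + reduced_cost ((U, 0) + (0, x)))
      = (\<lambda>U. J U x - l * (norm U)\<^sup>2)"
    by (simp add: fun_eq_iff mpc_cost_eq_reduced_cost inner_diff_right power2_norm_eq_inner)
  from convex_sum have "convex_on UNIV (\<lambda>U :: real^'m^'N::enum. J U x - l * (norm U)\<^sup>2)"
    unfolding sum_eq .
  then show ?thesis by (rule strongly_convex_onI[OF \<open>0 < l\<close>])
qed

lemma hessian_bounded_mpc_cost_inputs:
  "\<exists>\<sigma> L. 0 < \<sigma> \<and> 0 < L \<and> (\<forall>x. hessian_bounded (\<lambda>U :: real^'m^'N::enum. J U x) \<sigma> L)"
proof -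
  obtain l where "0 < l" and l: "\<And>h. l * (norm h)\<^sup>2 \<le> h \<bullet> (R *v h)"
    using pd_mat_coercive[OF R_pd] by blast
  have sym_R: "sym_mat R" using R_pd by (simp add: pd_mat_def)
  obtain L where L: "hessian_bounded (reduced_cost :: (real^'m^'N::enum) \<times> (real^'n) \<Rightarrow> real) 0 L"
    using hessian_bounded_reduced_cost by blast
  define T where "T = (\<lambda>U :: real^'m^'N::enum. (U, 0 :: real^'n))"
  have "linear T" by (simp add: T_def linear_iff)
  let ?LR = "2 * onorm (blockdiag R :: real^'m^'N::enum \<Rightarrow> _)"
  let ?LT = "L * onorm T * (onorm T + onorm (adjoint T))"
  have "has_hessian_bounds (\<lambda>U :: real^'m^'N::enum. U \<bullet> blockdiag R U) (\<lambda>U. 2 *\<^sub>R blockdiag R U)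
      (\<lambda>U h. 2 *\<^sub>R blockdiag R h) (2 * l) ?LR"
    by (intro has_hessian_bounds_quadratic_form linear_blockdiag blockdiag_symmetric[OF sym_R]
        blockdiag_coercive[OF l])
  moreover have "0 \<le> ?LR"
    using onorm_pos_le[of "blockdiag R :: real^'m^'N::enum \<Rightarrow> _"] linear_blockdiag[of R]
    by (simp add: linear_conv_bounded_linear)
  ultimately have input_part: "hessian_bounded (\<lambda>U :: real^'m^'N::enum. U \<bullet> blockdiag R U) (2 * l) ?LR"
    using \<open>0 < l\<close> unfolding hessian_bounded_def by auto
  have sum_bounded: "hessian_bounded (\<lambda>U. reduced_cost (T U + (0, x)) + U \<bullet> blockdiag R U) (0 + 2 * l) (?LT + ?LR)" for x
    by (rule hessian_bounded_add[OF hessian_bounded_linear_compose[OF L \<open>linear T\<close>] input_part])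
  have sum_eq: "(\<lambda>U. reduced_cost (T U + (0, x)) + U \<bullet> blockdiag R U) = (\<lambda>U. J U x)" for x
    unfolding T_def by (simp add: mpc_cost_eq_reduced_cost)
  have "hessian_bounded (\<lambda>U :: real^'m^'N::enum. J U x) (2 * l) (?LT + ?LR)" for x
    using sum_bounded[of x] unfolding sum_eq by simp
  then have "hessian_bounded (\<lambda>U :: real^'m^'N::enum. J U x) (2 * l) (max 1 (?LT + ?LR))" for x
    by (rule hessian_bounded_mono) simp
  with \<open>0 < l\<close> show ?thesis by (intro exI[of _ "2 * l"] exI[of _ "max 1 (?LT + ?LR)"]) auto
qed

lemma stage_le_quadratic:
  obtains a b where "0 \<le> a" and "0 \<le> b" and "\<And>y u. stage y u \<le> a * (norm y)\<^sup>2 + b * (norm u)\<^sup>2"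
proof -
  define a where "a = onorm ((*v) Q) + \<epsilon> * onorm ((*v) state.M)"
  define b where "b = onorm ((*v) R) + \<epsilon> * onorm ((*v) input.M)"
  have "0 \<le> a" "0 \<le> b"
    using eps_pos by (simp_all add: a_def b_def onorm_matrix_nonneg)
  moreover have "stage y u \<le> a * (norm y)\<^sup>2 + b * (norm u)\<^sup>2" for y u
  proof -
    have "\<epsilon> * rec_barrier \<delta> Cx dx wx y \<le> \<epsilon> * (onorm ((*v) state.M) * (norm y)\<^sup>2)"
      using order_trans[OF state.rec_barrier_le_quadratic quadratic_form_le_onorm] eps_pos
      by (intro mult_left_mono) auto
    moreover have "\<epsilon> * rec_barrier \<delta> Cu du wu u \<le> \<epsilon> * (onorm ((*v) input.M) * (norm u)\<^sup>2)"
      using order_trans[OF input.rec_barrier_le_quadratic quadratic_form_le_onorm] eps_pos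
      by (intro mult_left_mono) auto
    moreover have "y \<bullet> (Q *v y) \<le> onorm ((*v) Q) * (norm y)\<^sup>2" "u \<bullet> (R *v u) \<le> onorm ((*v) R) * (norm u)\<^sup>2"
      by (rule quadratic_form_le_onorm)+
    ultimately show ?thesis
      unfolding stage_cost_def a_def b_def by (simp add: algebra_simps)
  qed
  ultimately show ?thesis by (rule that)
qed

lemma mpc_cost_le_quadratic:
  obtains c where "0 < c" and "\<And>(U :: real^'m^'N::enum) x. J U x \<le> c * (norm (U, x))\<^sup>2"
proof -
  obtain a b where "0 \<le> a" "0 \<le> b" and stage_le: "\<And>y u. stage y u \<le> a * (norm y)\<^sup>2 + b * (norm u)\<^sup>2"
    using stage_le_quadratic by blast
  define T where "T k w = traj A B (snd w) (blk (fst w)) k" for k and w :: "(real^'m^'N::enum) \<times> (real^'n)"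
  have T_le: "(norm (T k w))\<^sup>2 \<le> (onorm (T k))\<^sup>2 * (norm w)\<^sup>2" for k w
  proof -
    have "bounded_linear (T k)"
      using linear_traj unfolding T_def linear_conv_bounded_linear[symmetric] by blast
    then have "norm (T k w) \<le> onorm (T k) * norm w" by (rule onorm)
    then show ?thesis by (simp add: power_mono power_mult_distrib[symmetric])
  qed
  define c where "c = (\<Sum>k<CARD('N). a * (onorm (T k))\<^sup>2 + b) + onorm ((*v) P) * (onorm (T CARD('N)))\<^sup>2 + 1"
  have "0 < c"
    unfolding c_def using \<open>0 \<le> a\<close> \<open>0 \<le> b\<close>
    by (intro add_nonneg_pos add_nonneg_nonneg sum_nonneg mult_nonneg_nonneg onorm_matrix_nonneg) auto
  moreover have "J U x \<le> c * (norm (U, x))\<^sup>2" for U :: "real^'m^'N::enum" and x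
  proof -
    have "stage (T k (U, x)) (blk U k) \<le> (a * (onorm (T k))\<^sup>2 + b) * (norm (U, x))\<^sup>2" for k
    proof -
      have "(norm (blk U k))\<^sup>2 \<le> (norm (U, x))\<^sup>2"
        using order_trans[OF norm_blk_le norm_fst_le[of U x]] by (simp add: power_mono)
      then have "a * (norm (T k (U, x)))\<^sup>2 + b * (norm (blk U k))\<^sup>2
          \<le> a * ((onorm (T k))\<^sup>2 * (norm (U, x))\<^sup>2) + b * (norm (U, x))\<^sup>2"
        using \<open>0 \<le> a\<close> \<open>0 \<le> b\<close> T_le by (intro add_mono mult_left_mono) auto
      with stage_le show ?thesis by (smt (verit) distrib_right mult.assoc)
    qed
    moreover have "T N (U, x) \<bullet> (P *v T N (U, x)) \<le> onorm ((*v) P) * (onorm (T N))\<^sup>2 * (norm (U, x))\<^sup>2" for N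
      using order_trans[OF quadratic_form_le_onorm mult_left_mono[OF T_le onorm_matrix_nonneg]]
      by (simp add: mult.assoc)
    ultimately have "J U x \<le> (\<Sum>k<CARD('N). (a * (onorm (T k))\<^sup>2 + b) * (norm (U, x))\<^sup>2)
        + onorm ((*v) P) * (onorm (T CARD('N)))\<^sup>2 * (norm (U, x))\<^sup>2"
      unfolding mpc_cost_def T_def by (intro add_mono sum_mono) auto
    also have "\<dots> = ((\<Sum>k<CARD('N). a * (onorm (T k))\<^sup>2 + b) + onorm ((*v) P) * (onorm (T CARD('N)))\<^sup>2)
        * (norm (U, x))\<^sup>2"
      by (simp add: sum_distrib_right distrib_right)
    also have "\<dots> \<le> c * (norm (U, x))\<^sup>2"
      by (simp add: c_def distrib_right)
    finally show ?thesis .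
  qed
  ultimately show ?thesis by (rule that)
qed

lemma stage_ge: "u \<bullet> (R *v u) + \<epsilon> * rec_barrier \<delta> Cx dx wx y \<le> stage y u"
  using input.rec_barrier_nonneg[of u] eps_pos Q_psd unfolding stage_cost_def psd_mat_def by simp

lemma mpc_cost_ge:
  assumes "compact {x. \<forall>i. (Cx *v x) $ i \<le> dx $ i}"
  obtains l m \<kappa> where "0 < l" and "0 < m" and "0 < \<kappa>"
    and "\<And>(U :: real^'m^'N::enum) x. l * (norm U)\<^sup>2 + m * quad_lin (norm x / \<kappa>) \<le> J U x"
proof -
  obtain l where "0 < l" and l: "\<And>h. l * (norm h)\<^sup>2 \<le> h \<bullet> (R *v h)"
    using pd_mat_coercive[OF R_pd] by blast
  obtain \<kappa> where "0 < \<kappa>" and \<kappa>: "\<And>x. \<exists>i. norm x \<le> \<kappa> * \<bar>Cx $ i \<bullet> x\<bar>"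
    using compact_polytope_norm_le_row[OF assms] state.delta_pos state.delta_le
    by (metis order_less_le_trans)
  define D where "D = Max (range (\<lambda>i. dx $ i))"
  have D: "dx $ i \<le> D" for i unfolding D_def by (rule Max_ge) auto
  define m where "m = \<epsilon> / (2 * (D + 1)\<^sup>2)"
  have "0 < D + 1" using state.delta_pos state.delta_le D by (meson add_pos_pos order.strict_trans2 zero_less_one)
  then have "0 < m" using eps_pos by (simp add: m_def)
  have barrier_ge: "m * quad_lin (norm x / \<kappa>) \<le> \<epsilon> * rec_barrier \<delta> Cx dx wx x" for x
  proof -
    obtain i where "norm x \<le> \<kappa> * \<bar>Cx $ i \<bullet> x\<bar>" using \<kappa> by blast
    then have "quad_lin (norm x / \<kappa>) \<le> quad_lin \<bar>Cx $ i \<bullet> x\<bar>"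
      using \<open>0 < \<kappa>\<close> by (intro quad_lin_mono) (auto simp: field_simps)
    also have "\<dots> \<le> 2 * (D + 1)\<^sup>2 * rec_barrier \<delta> Cx dx wx x"
      using state.rec_barrier_ge_row[OF D, of i x] \<open>0 < D + 1\<close> by (simp add: field_simps)
    finally show ?thesis
      using eps_pos \<open>0 < D + 1\<close> by (simp add: m_def field_simps mult_left_mono)
  qed
  have "l * (norm U)\<^sup>2 + m * quad_lin (norm x / \<kappa>) \<le> J U x" for U :: "real^'m^'N::enum" and x
  proof -
    let ?x = "traj A B x (blk U)"
    have "l * (norm U)\<^sup>2 \<le> (\<Sum>k<CARD('N). blk U k \<bullet> (R *v blk U k))"
      unfolding sum_blk_quadratic_form by (rule blockdiag_coercive[OF l])
    moreover have "\<epsilon> * rec_barrier \<delta> Cx dx wx x \<le> (\<Sum>k<CARD('N). \<epsilon> * rec_barrier \<delta> Cx dx wx (?x k))"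
      using member_le_sum[of 0 "{..<CARD('N)}" "\<lambda>k. \<epsilon> * rec_barrier \<delta> Cx dx wx (?x k)"]
        state.rec_barrier_nonneg eps_pos by simp
    moreover have "(\<Sum>k<CARD('N). blk U k \<bullet> (R *v blk U k) + \<epsilon> * rec_barrier \<delta> Cx dx wx (?x k))
        \<le> (\<Sum>k<CARD('N). stage (?x k) (blk U k))"
      by (intro sum_mono stage_ge)
    moreover have "0 \<le> ?x CARD('N) \<bullet> (P *v ?x CARD('N))"
      using P_pd by (simp add: pd_mat_imp_psd_mat[unfolded psd_mat_def])
    ultimately show ?thesis
      using barrier_ge[of x] unfolding mpc_cost_def sum.distrib by linarith
  qed
  with \<open>0 < l\<close> \<open>0 < m\<close> \<open>0 < \<kappa>\<close> show ?thesis by (rule that)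
qed

lemma mpc_cost_K_inf_bounds:
  assumes "compact {x. \<forall>i. (Cx *v x) $ i \<le> dx $ i}"
  shows "\<exists>\<alpha>l \<alpha>u. K_inf \<alpha>l \<and> K_inf \<alpha>u \<and>
    (\<forall>(U :: real^'m^'N::enum) x. \<alpha>l (norm (U, x)) \<le> J U x \<and> J U x \<le> \<alpha>u (norm (U, x)))"
proof -
  obtain c where "0 < c" and upper: "\<And>(U :: real^'m^'N::enum) x. J U x \<le> c * (norm (U, x))\<^sup>2"
    using mpc_cost_le_quadratic by blast
  obtain l m \<kappa> where "0 < l" "0 < m" "0 < \<kappa>"
    and lower: "\<And>(U :: real^'m^'N::enum) x. l * (norm U)\<^sup>2 + m * quad_lin (norm x / \<kappa>) \<le> J U x"
    using mpc_cost_ge[OF assms] by blast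
  define c' where "c' = min (l / 4) (m / (max 1 (2 * \<kappa>))\<^sup>2)"
  have "0 < c'" using \<open>0 < l\<close> \<open>0 < m\<close> by (simp add: c'_def)
  have "c' * quad_lin (norm (U, x)) \<le> J U x" for U :: "real^'m^'N::enum" and x
    using quad_lin_le_split[OF \<open>0 < l\<close> \<open>0 < m\<close> \<open>0 < \<kappa>\<close> norm_ge_zero norm_ge_zero norm_ge_zero
        norm_Pair_le[of U x]] lower[of U x]
    unfolding c'_def by linarith
  with upper show ?thesis
    using K_inf_scaled_quad_lin[OF \<open>0 < c'\<close>] K_inf_scaled_square[OF \<open>0 < c\<close>] by blast
qed

lemma mpc_cost_shift_in:
  fixes U :: "real^'m^'N::enum" and x :: "real^'n" and v :: "real^'m"
  defines "y \<equiv> traj A B x (blk U) CARD('N)"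
  shows "J (shift_in U v) (A *v x + B *v blk U 0) = J U x - stage x (blk U 0) + stage y v
    + (A *v y + B *v v) \<bullet> (P *v (A *v y + B *v v)) - y \<bullet> (P *v y)"
proof -
  define N where "N = CARD('N)"
  have "0 < N" by (simp add: N_def)
  define u where "u j = (if j < N then blk U j else v)" for j
  define G where "G k = stage (traj A B x u k) (u k)" for k
  have traj_U: "traj A B x (blk U) k = traj A B x u k" if "k \<le> N" for k
    using that by (auto simp: u_def intro!: traj_cong)
  have blk_shifted: "blk (shift_in U v) k = u (Suc k)" if "k < N" for k
    using that blk_shift_in[of k U v] by (simp add: u_def N_def)
  have traj_shifted: "traj A B (A *v x + B *v blk U 0) (blk (shift_in U v)) k = traj A B x u (Suc k)"
    if "k \<le> N" for k
  proof -
    have "traj A B (A *v x + B *v blk U 0) (blk (shift_in U v)) k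
        = traj A B (A *v x + B *v u 0) (\<lambda>j. u (Suc j)) k"
      using that \<open>0 < N\<close> blk_shifted by (auto simp: u_def intro!: traj_cong)
    then show ?thesis by (simp only: traj_shift)
  qed
  have "J (shift_in U v) (A *v x + B *v blk U 0)
      = (\<Sum>k<N. G (Suc k)) + traj A B x u (Suc N) \<bullet> (P *v traj A B x u (Suc N))"
  proof -
    have "(\<Sum>k<N. stage (traj A B (A *v x + B *v blk U 0) (blk (shift_in U v)) k) (blk (shift_in U v) k))
        = (\<Sum>k<N. G (Suc k))"
      using blk_shifted traj_shifted by (intro sum.cong) (auto simp: G_def simp del: traj.simps)
    then show ?thesis
      using traj_shifted[of N] unfolding mpc_cost_def N_def[symmetric] by (simp del: traj.simps)
  qed
  moreover have "J U x = (\<Sum>k<N. G k) + traj A B x u N \<bullet> (P *v traj A B x u N)"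
  proof -
    have "(\<Sum>k<N. stage (traj A B x (blk U) k) (blk U k)) = (\<Sum>k<N. G k)"
      using traj_U by (intro sum.cong) (auto simp: G_def u_def simp del: traj.simps)
    then show ?thesis using traj_U[of N] unfolding mpc_cost_def N_def[symmetric] by simp
  qed
  moreover have "(\<Sum>k<N. G (Suc k)) = (\<Sum>k<N. G k) + G N - G 0"
    using sum.lessThan_Suc_shift[of G N] sum.lessThan_Suc[of G N] by simp
  moreover have "traj A B x u N = y" using traj_U[of N] by (simp add: y_def N_def)
  moreover have "G N = stage y v" and "G 0 = stage x (blk U 0)"
    using \<open>traj A B x u N = y\<close> \<open>0 < N\<close> by (simp_all add: G_def u_def)
  moreover have "traj A B x u (Suc N) = A *v y + B *v v"
    using \<open>traj A B x u N = y\<close> by (simp add: u_def)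
  ultimately show ?thesis by simp
qed

text \<open>The Riccati equation makes \<open>x\<^sup>T P x\<close> decrease along \<open>u = K x\<close> by exactly the stage cost in
  which the barriers are replaced by their quadratic majorants \<open>M\<^sub>x\<close>, \<open>M\<^sub>u\<close>.\<close>
lemma riccati_stage_decrease:
  assumes riccati: "P = transpose (A + B ** K) ** P ** (A + B ** K)
      + transpose K ** (R + \<epsilon> *\<^sub>R input.M) ** K + Q + \<epsilon> *\<^sub>R state.M"
  shows "stage y (K *v y) + (A *v y + B *v (K *v y)) \<bullet> (P *v (A *v y + B *v (K *v y))) \<le> y \<bullet> (P *v y)"
proof -
  define F where "F = A + B ** K"
  have Fy: "F *v y = A *v y + B *v (K *v y)"
    by (simp add: F_def matrix_vector_mult_add_rdistrib matrix_vector_mul_assoc)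
  have "y \<bullet> (P *v y) = y \<bullet> ((transpose F ** P ** F) *v y) + y \<bullet> ((transpose K ** (R + \<epsilon> *\<^sub>R input.M) ** K) *v y)
      + y \<bullet> (Q *v y) + y \<bullet> ((\<epsilon> *\<^sub>R state.M) *v y)"
    by (subst riccati) (simp only: F_def matrix_vector_mult_add_rdistrib inner_add_right)
  also have "\<dots> = (F *v y) \<bullet> (P *v (F *v y)) + (K *v y) \<bullet> (R *v (K *v y))
      + \<epsilon> * ((K *v y) \<bullet> (input.M *v (K *v y))) + y \<bullet> (Q *v y) + \<epsilon> * (y \<bullet> (state.M *v y))"
    by (simp only: quadratic_form_congruence matrix_vector_mult_add_rdistrib inner_add_right
        scaleR_matrix_vector_assoc[symmetric] inner_scaleR_right)
  finally have expand: "y \<bullet> (P *v y) = (F *v y) \<bullet> (P *v (F *v y)) + (K *v y) \<bullet> (R *v (K *v y))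
      + \<epsilon> * ((K *v y) \<bullet> (input.M *v (K *v y))) + y \<bullet> (Q *v y) + \<epsilon> * (y \<bullet> (state.M *v y))" .
  have "\<epsilon> * rec_barrier \<delta> Cx dx wx y \<le> \<epsilon> * (y \<bullet> (state.M *v y))"
    using state.rec_barrier_le_quadratic eps_pos by (intro mult_left_mono) auto
  moreover have "\<epsilon> * rec_barrier \<delta> Cu du wu (K *v y) \<le> \<epsilon> * ((K *v y) \<bullet> (input.M *v (K *v y)))"
    using input.rec_barrier_le_quadratic eps_pos by (intro mult_left_mono) auto
  ultimately show ?thesis
    unfolding expand Fy[symmetric] stage_cost_def by linarith
qed

lemma mpc_cost_shift_decrease:
  assumes "P = transpose (A + B ** K) ** P ** (A + B ** K)
      + transpose K ** (R + \<epsilon> *\<^sub>R input.M) ** K + Q + \<epsilon> *\<^sub>R state.M"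
  shows "\<exists>kf :: real^'m^'N::enum \<Rightarrow> real^'n \<Rightarrow> real^'m. kf 0 0 = 0 \<and>
    (\<forall>U x. J (shift_in U (kf U x)) (A *v x + B *v blk U 0) - J U x \<le> - stage x (blk U 0))"
proof (intro exI conjI allI)
  show "K *v traj A B 0 (blk (0 :: real^'m^'N::enum)) CARD('N) = 0"
    by (simp add: blk_zero traj_zero)
  fix U :: "real^'m^'N::enum" and x
  show "J (shift_in U (K *v traj A B x (blk U) CARD('N))) (A *v x + B *v blk U 0) - J U x \<le> - stage x (blk U 0)"
    unfolding mpc_cost_shift_in using riccati_stage_decrease[OF assms] by (smt (verit))
qed

end

theorem lemma1:
  fixes A :: "real^'n^'n" and B :: "real^'m^'n"
    and Cx :: "real^'n^'qx::finite" and dx :: "real^'qx"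
    and Cu :: "real^'m^'qu::finite" and du :: "real^'qu"
    and Q P :: "real^'n^'n" and R :: "real^'m^'m"
    and \<epsilon> \<delta> :: real and wx :: "real^'qx" and wu :: "real^'qu"
    and K :: "real^'n^'m"
  assumes stab: "stabilizable A B"
    and Xcomp: "compact {x. \<forall>i. (Cx *v x) $ i \<le> dx $ i}"
    and Ucomp: "compact {u. \<forall>j. (Cu *v u) $ j \<le> du $ j}"
    and dx_pos: "\<forall>i. 0 < dx $ i" and du_pos: "\<forall>j. 0 < du $ j"
    and eps: "\<epsilon> > 0"
    and Qpsd: "psd_mat Q" and Rpd: "pd_mat R"
    and delta_pos: "0 < \<delta>"
    and delta_x: "\<forall>i. \<delta> \<le> dx $ i" and delta_u: "\<forall>j. \<delta> \<le> du $ j"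
    and wx_nn: "\<forall>i. 0 \<le> wx $ i" and wu_nn: "\<forall>j. 0 \<le> wu $ j"
    and wx_cent: "transpose Cx *v (\<chi> i. (1 + wx $ i) / dx $ i) = 0"
    and wu_cent: "transpose Cu *v (\<chi> j. (1 + wu $ j) / du $ j) = 0"
    and Ppd: "pd_mat P"
    and K_def: "K = - (matrix_inv (R + transpose B ** P ** B
                   + \<epsilon> *\<^sub>R ((1 / (2 * \<delta>\<^sup>2)) *\<^sub>R (transpose Cu ** diag_mat (1 + wu) ** Cu)))
                   ** transpose B ** P ** A)"
    and Ric: "P = transpose (A + B ** K) ** P ** (A + B ** K)
                 + transpose K ** (R + \<epsilon> *\<^sub>R ((1 / (2 * \<delta>\<^sup>2)) *\<^sub>R (transpose Cu ** diag_mat (1 + wu) ** Cu))) ** K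
                 + Q + \<epsilon> *\<^sub>R ((1 / (2 * \<delta>\<^sup>2)) *\<^sub>R (transpose Cx ** diag_mat (1 + wx) ** Cx))"
  shows
    "(\<exists>\<alpha>l \<alpha>u. K_inf \<alpha>l \<and> K_inf \<alpha>u \<and>
        (\<forall>(U :: real^'m^'N::enum) x.
           \<alpha>l (norm (U, x)) \<le> mpc_cost A B Q R P \<epsilon> \<delta> Cx dx wx Cu du wu U x \<and>
           mpc_cost A B Q R P \<epsilon> \<delta> Cx dx wx Cu du wu U x \<le> \<alpha>u (norm (U, x))))
     \<and> (\<forall>x. strongly_convex_on UNIV (\<lambda>U :: real^'m^'N::enum. mpc_cost A B Q R P \<epsilon> \<delta> Cx dx wx Cu du wu U x))
     \<and> (\<forall>U :: real^'m^'N::enum. convex_on UNIV (\<lambda>x. mpc_cost A B Q R P \<epsilon> \<delta> Cx dx wx Cu du wu U x))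
     \<and> (\<exists>\<sigma> L. \<sigma> > 0 \<and> L > 0 \<and>
          (\<forall>x. \<exists>(g :: real^'m^'N::enum \<Rightarrow> real^'m^'N::enum) H.
             (\<forall>U. ((\<lambda>V. mpc_cost A B Q R P \<epsilon> \<delta> Cx dx wx Cu du wu V x) has_derivative (\<lambda>h. g U \<bullet> h)) (at U)
                  \<and> (g has_derivative H U) (at U)
                  \<and> (\<forall>h. \<sigma> * (norm h)\<^sup>2 \<le> h \<bullet> H U h \<and> h \<bullet> H U h \<le> L * (norm h)\<^sup>2))
             \<and> (\<forall>U1 U2. norm (g U1 - g U2) \<le> L * norm (U1 - U2))))
     \<and> (\<exists>kf :: real^'m^'N::enum \<Rightarrow> real^'n \<Rightarrow> real^'m. kf 0 0 = 0 \<and>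
          (\<forall>U0 x0.
             mpc_cost A B Q R P \<epsilon> \<delta> Cx dx wx Cu du wu (shift_in U0 (kf U0 x0)) (A *v x0 + B *v blk U0 0)
             - mpc_cost A B Q R P \<epsilon> \<delta> Cx dx wx Cu du wu U0 x0
             \<le> - stage_cost Q R \<epsilon> \<delta> Cx dx wx Cu du wu x0 (blk U0 0)))"
proof -
  interpret relaxed_barrier_mpc \<delta> Cx dx wx Cu du wu A B Q P R \<epsilon>
    by unfold_locales (use assms in auto)
  show ?thesis
    using mpc_cost_K_inf_bounds[OF Xcomp] strongly_convex_on_mpc_cost_inputs convex_on_mpc_cost_state
      hessian_bounded_mpc_cost_inputs mpc_cost_shift_decrease[OF Ric]
    unfolding hessian_bounded_def has_hessian_bounds_def by (intro conjI) blast+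
qed

end
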